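(* Let $A$ and $B$ be unital $C^{*}$-algebras. Suppose that a surjective map $\phi\colon A_{sa} \to B_{sa}$ (not assumed to be linear or continuous) satisfies \[ \sigma(\phi(a)\phi(b))=\sigma(ab) \quad \text{for all } a,b \in A_{sa}. \] Then there exist a central symmetry $s \in B_{sa}$ and a Jordan isomorphism $J\colon A_{sa} \to B_{sa}$ such that \[ \phi(a)=sJ(a) \quad \text{for all } a \in A_{sa}. \]
   Context: $C^*$-algebras are complex. For a unital $C^*$-algebra $A$, $A_{sa}$ denotes the set of all self-adjoint elements of $A$, and $\sigma(x)$ denotes the spectrum of an element $x$ in the algebra. The Jordan product is $a\circ b=\frac12(ab+ba)$; it maps $A_{sa}\times A_{sa}$ into $A_{sa}$. A real-linear map $J\colon A_{sa}\to B_{sa}$ is a Jordan homomorphism if $J(a\circ b)=J(a)\circ J(b)$ for all $a,b\in A_{sa}$; a bijective Jordan homomorphism is called a Jordan isomorphism. A symmetry is a self-adjoint unitary element; a central symmetry of $B$ is a symmetry that commutes with every element of $B$. *)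

theory Defs
  imports Complex_Main
begin

(* Instead of a class with 0 \<noteq> 1 (such as ring_1 or real_normed_algebra_1), the unit is
   supplied by monoid_mult, so that the zero algebra is not excluded.  The norm of 1 is 1 in
   every other algebra, by the C*-identity.  The real structure inherited from
   real_normed_algebra is the restriction of the complex one. *)
class unital_cstar_algebra = real_normed_algebra + banach + monoid_mult +
  fixes scaleC :: "complex \<Rightarrow> 'a \<Rightarrow> 'a"  (infixr "*\<^sub>C" 75)
    and star :: "'a \<Rightarrow> 'a"
  assumes scaleC_add_right: "c *\<^sub>C (x + y) = c *\<^sub>C x + c *\<^sub>C y"
    and scaleC_add_left: "(c + d) *\<^sub>C x = c *\<^sub>C x + d *\<^sub>C x"
    and scaleC_scaleC: "c *\<^sub>C d *\<^sub>C x = (c * d) *\<^sub>C x"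
    and scaleC_of_real: "complex_of_real r *\<^sub>C x = r *\<^sub>R x"
    and mult_scaleC_left: "(c *\<^sub>C x) * y = c *\<^sub>C (x * y)"
    and mult_scaleC_right: "x * (c *\<^sub>C y) = c *\<^sub>C (x * y)"
    and norm_scaleC: "norm (c *\<^sub>C x) = cmod c * norm x"
    and star_add: "star (x + y) = star x + star y"
    and star_scaleC: "star (c *\<^sub>C x) = cnj c *\<^sub>C star x"
    and star_mult: "star (x * y) = star y * star x"
    and star_star: "star (star x) = x"
    and cstar_identity: "norm (star x * x) = (norm x)\<^sup>2"

definition self_adjoints :: "'a::unital_cstar_algebra set"
  where "self_adjoints = {x. star x = x}"

definition two_sided_invertible :: "'a::unital_cstar_algebra \<Rightarrow> bool"
  where "two_sided_invertible x \<longleftrightarrow> (\<exists>y. x * y = 1 \<and> y * x = 1)"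

definition alg_spectrum :: "'a::unital_cstar_algebra \<Rightarrow> complex set"
  where "alg_spectrum x = {c. \<not> two_sided_invertible (c *\<^sub>C 1 - x)}"

definition jordan_product :: "'a::unital_cstar_algebra \<Rightarrow> 'a \<Rightarrow> 'a"
  where "jordan_product a b = (1/2) *\<^sub>R (a * b + b * a)"

(* Only the values on self-adjoint elements matter: a map between the self-adjoint parts is
   represented by a function on the whole algebra whose other values are irrelevant. *)
definition jordan_homomorphism ::
    "('a::unital_cstar_algebra \<Rightarrow> 'b::unital_cstar_algebra) \<Rightarrow> bool"
  where "jordan_homomorphism J \<longleftrightarrow>
    (\<forall>a\<in>self_adjoints. J a \<in> self_adjoints) \<and>
    (\<forall>a\<in>self_adjoints. \<forall>b\<in>self_adjoints. J (a + b) = J a + J b) \<and>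
    (\<forall>r. \<forall>a\<in>self_adjoints. J (r *\<^sub>R a) = r *\<^sub>R J a) \<and>
    (\<forall>a\<in>self_adjoints. \<forall>b\<in>self_adjoints.
       J (jordan_product a b) = jordan_product (J a) (J b))"

definition jordan_isomorphism ::
    "('a::unital_cstar_algebra \<Rightarrow> 'b::unital_cstar_algebra) \<Rightarrow> bool"
  where "jordan_isomorphism J \<longleftrightarrow>
    jordan_homomorphism J \<and> bij_betw J self_adjoints self_adjoints"

definition unitary_element :: "'a::unital_cstar_algebra \<Rightarrow> bool"
  where "unitary_element u \<longleftrightarrow> star u * u = 1 \<and> u * star u = 1"

definition symmetry_element :: "'a::unital_cstar_algebra \<Rightarrow> bool"
  where "symmetry_element s \<longleftrightarrow> s \<in> self_adjoints \<and> unitary_element s"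

definition central_symmetry :: "'a::unital_cstar_algebra \<Rightarrow> bool"
  where "central_symmetry s \<longleftrightarrow> symmetry_element s \<and> (\<forall>x. s * x = x * s)"

end

theory Submission
  imports Defs "HOL-Analysis.Analysis"
begin

text \<open>
  Put \<open>s = \<phi>(1)\<close>. Then \<open>\<sigma>(s\<^sup>2) = {1}\<close> gives \<open>s\<^sup>2 = 1\<close>. For self-adjoint \<open>x\<close> the element \<open>y = x - s x s\<close>
  is a value of \<open>\<phi>\<close>, so \<open>s y = s x - x s\<close> has real spectrum; being skew-adjoint it vanishes, and
  \<open>s\<close> is central. Hence one may replace \<open>\<phi>\<close> by \<open>f = s \<phi>\<close>, which is unital.

  For positive invertible \<open>x\<close>, \<open>a \<le> t x\<close> holds iff \<open>\<sigma>(a x\<^sup>-\<^sup>1)\<close> has no real point above \<open>t\<close>. So \<open>f\<close> is a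
  homogeneous order isomorphism between the cones of positive invertible elements. A Mazur--Ulam
  argument with the reflections \<open>y \<mapsto> m y\<^sup>-\<^sup>1 m\<close>, which are antitone, yields \<open>f(x y x) = f(x) f(y) f(x)\<close>.
  Comparing \<open>(1 + x)\<^sup>n\<close> with each of its binomial terms and taking \<open>n\<close>-th roots gives
  \<open>f(1 + x) \<ge> 1 + f(x)\<close>, with equality by symmetry, and the triple identity turns this into
  additivity on the cone. The additive extension of \<open>f\<close> from the cone to all self-adjoint elements
  is a Jordan isomorphism. It agrees with \<open>f\<close> because a self-adjoint \<open>p\<close> is determined by the
  positive invertible \<open>y\<close> for which \<open>y - p\<close> and \<open>y + p\<close> are invertible.
\<close>

section \<open>Involution and inverses\<close>

lemma star_zero [simp]: "star (0::'a::unital_cstar_algebra) = 0"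
  by (metis add_cancel_right_left star_add)

lemma star_minus: "star (- x) = - star (x::'a::unital_cstar_algebra)"
  by (metis add_eq_0_iff star_add star_zero)

lemma star_diff: "star (x - y) = star x - star (y::'a::unital_cstar_algebra)"
  by (metis diff_conv_add_uminus star_add star_minus)

lemma star_one [simp]: "star (1::'a::unital_cstar_algebra) = 1"
  by (metis mult_1_right star_mult star_star)

lemma star_scaleR: "star (r *\<^sub>R x) = r *\<^sub>R star (x::'a::unital_cstar_algebra)"
  by (metis scaleC_of_real star_scaleC complex_cnj_complex_of_real)

lemma norm_star: "norm (star x) = norm (x::'a::unital_cstar_algebra)"
proof -
  have le: "norm y \<le> norm (star y)" for y :: 'a
  proof (cases "norm y = 0")
    case False
    have "norm y * norm y \<le> norm (star y) * norm y"
      using norm_mult_ineq[of "star y" y] cstar_identity[of y] by (simp add: power2_eq_square)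
    then show ?thesis using False by simp
  qed auto
  from le[of x] le[of "star x"] show ?thesis by (simp add: star_star)
qed

lemma norm_square_sa:
  fixes x :: "'a::unital_cstar_algebra"
  assumes "star x = x" shows "norm (x * x) = (norm x)\<^sup>2"
  using cstar_identity[of x] assms by simp

text \<open>The C*-identity makes the norm of 1 idempotent, so it is 1, or 0 in the zero algebra;
  hence an inequality.\<close>

lemma norm_one_le: "norm (1::'a::unital_cstar_algebra) \<le> 1"
  using norm_square_sa[of "1::'a"] by (cases "norm (1::'a) = 0") (simp_all add: power2_eq_square)

lemma norm_scaleR_one_le: "norm (r *\<^sub>R (1::'a::unital_cstar_algebra)) \<le> \<bar>r\<bar>"
  using norm_one_le[where 'a='a] by (simp add: mult_left_le)

lemmas star_simps = star_add star_diff star_minus star_mult star_scaleR star_star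

definition cinv :: "'a::unital_cstar_algebra \<Rightarrow> 'a"
  where "cinv x = (SOME y. x * y = 1 \<and> y * x = 1)"

lemma cinv:
  assumes "two_sided_invertible x"
  shows "x * cinv x = 1" "cinv x * x = 1"
  using someI_ex[of "\<lambda>y. x * y = 1 \<and> y * x = 1"] assms
  unfolding two_sided_invertible_def cinv_def by auto

lemma invertibleI: "x * y = 1 \<Longrightarrow> y * x = 1 \<Longrightarrow> two_sided_invertible x"
  unfolding two_sided_invertible_def by auto

lemma cinv_eqI:
  assumes "x * y = 1" "y * x = 1" shows "cinv x = y"
  by (metis assms cinv(1) invertibleI mult.assoc mult_1_left mult_1_right)

lemma invertible_cinv: "two_sided_invertible x \<Longrightarrow> two_sided_invertible (cinv x)"
  by (meson cinv invertibleI)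

lemma cinv_cinv: "two_sided_invertible x \<Longrightarrow> cinv (cinv x) = x"
  by (simp add: cinv cinv_eqI)

lemma invertible_one: "two_sided_invertible 1"
  by (meson invertibleI mult_1_right)

lemma cinv_assoc:
  assumes "two_sided_invertible x"
  shows "x * (cinv x * y) = y" "cinv x * (x * y) = y"
  using assms by (metis cinv mult.assoc mult_1_left)+

lemma cinv_mult:
  assumes "two_sided_invertible x" "two_sided_invertible y"
  shows "cinv (x * y) = cinv y * cinv x" "two_sided_invertible (x * y)"
proof -
  have "x * y * (cinv y * cinv x) = 1" "cinv y * cinv x * (x * y) = 1"
    using assms by (simp_all add: mult.assoc cinv cinv_assoc)
  then show "cinv (x * y) = cinv y * cinv x" "two_sided_invertible (x * y)"
    by (auto intro: cinv_eqI invertibleI)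
qed

lemma invertible_of_mult_right:
  fixes x y :: "'a::unital_cstar_algebra"
  assumes "two_sided_invertible y" "two_sided_invertible (x * y)"
  shows "two_sided_invertible x"
proof -
  have "x = x * y * cinv y" using assms(1) by (simp add: mult.assoc cinv)
  then show ?thesis using assms cinv_mult(2) invertible_cinv by metis
qed

text \<open>The inverse of \<open>x * y\<close> yields a right inverse of \<open>x\<close> and,
  since the factors commute, a left one; associativity identifies the two.\<close>

lemma invertible_of_commuting_mult:
  fixes x y :: "'a::unital_cstar_algebra"
  assumes "x * y = y * x" "two_sided_invertible (x * y)"
  shows "two_sided_invertible x"
proof (rule invertibleI)
  let ?c = "cinv (x * y)"
  show r: "x * (y * ?c) = 1" using cinv(1)[OF assms(2)] by (simp add: mult.assoc)
  have l: "(?c * y) * x = 1" using cinv(2)[OF assms(2)] assms(1) by (simp add: mult.assoc)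
  have "?c * y = ?c * y * (x * (y * ?c))" using r by simp
  also have "\<dots> = y * ?c" using l by (metis mult.assoc mult_1_left)
  finally show "(y * ?c) * x = 1" using l by simp
qed

lemma scaleR_cinv:
  fixes x :: "'a::unital_cstar_algebra"
  assumes "two_sided_invertible x" "r \<noteq> 0"
  shows "cinv (r *\<^sub>R x) = (1 / r) *\<^sub>R cinv x" "two_sided_invertible (r *\<^sub>R x)"
proof -
  have "r *\<^sub>R x * ((1 / r) *\<^sub>R cinv x) = 1" "((1 / r) *\<^sub>R cinv x) * r *\<^sub>R x = 1"
    using assms cinv[of x] by simp_all
  then show "cinv (r *\<^sub>R x) = (1 / r) *\<^sub>R cinv x" "two_sided_invertible (r *\<^sub>R x)"
    by (blast intro: cinv_eqI invertibleI)+
qed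

lemma invertible_minus: "two_sided_invertible (- x) \<longleftrightarrow> two_sided_invertible x"
  using scaleR_cinv(2)[of x "-1"] scaleR_cinv(2)[of "-x" "-1"] by auto

lemma star_cinv:
  fixes x :: "'a::unital_cstar_algebra"
  assumes "two_sided_invertible x"
  shows "star (cinv x) = cinv (star x)" "two_sided_invertible (star x)"
proof -
  have "star x * star (cinv x) = 1" "star (cinv x) * star x = 1"
    using assms by (metis cinv star_mult star_one)+
  then show "star (cinv x) = cinv (star x)" "two_sided_invertible (star x)"
    by (auto intro: cinv_eqI[symmetric] invertibleI)
qed

section \<open>Inverses and square roots near the identity\<close>

lemma neumann:
  fixes z :: "'a::unital_cstar_algebra"
  assumes "norm z < 1"
  shows "two_sided_invertible (1 - z)"
proof -
  \<comment> \<open>The right inverse \<open>y = 1 + z * y\<close> and the left inverse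
    \<open>y' = 1 + y' * z\<close> are fixed points of contractions with factor
    \<open>norm z\<close>; they coincide by associativity.\<close>
  have "\<exists>!y\<in>UNIV. 1 + z * y = y"
    by (rule Banach_fix[of UNIV "norm z", OF complete_UNIV])
       (use assms in \<open>auto simp: dist_norm norm_mult_ineq simp flip: right_diff_distrib\<close>)
  then obtain y where y: "1 + z * y = y" by auto
  have "\<exists>!y\<in>UNIV. 1 + y * z = y"
    by (rule Banach_fix[of UNIV "norm z", OF complete_UNIV])
       (use assms in \<open>auto simp: dist_norm norm_mult_ineq mult.commute[of "norm z"] simp flip: left_diff_distrib\<close>)
  then obtain y' where y': "1 + y' * z = y'" by auto
  have 1: "(1 - z) * y = 1" using y by (simp add: algebra_simps)
  have 2: "y' * (1 - z) = 1" using y' by (simp add: algebra_simps)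
  have "y' = y" using 1 2 by (metis mult.assoc mult_1_left mult_1_right)
  then show ?thesis using 1 2 by (auto intro: invertibleI)
qed

lemma neumann_scaled:
  fixes z :: "'a::unital_cstar_algebra"
  assumes "norm z < t"
  shows "two_sided_invertible (t *\<^sub>R 1 - z)"
proof -
  have t: "t > 0" using assms norm_ge_zero[of z] by linarith
  have "two_sided_invertible (1 - (1 / t) *\<^sub>R z)"
    by (rule neumann) (use assms t in \<open>simp add: field_simps\<close>)
  moreover have "t *\<^sub>R 1 - z = t *\<^sub>R (1 - (1 / t) *\<^sub>R z)"
    using t by (simp add: scaleR_diff_right)
  ultimately show ?thesis using scaleR_cinv(2) t by (metis less_irrefl)
qed

lemma continuous_on_star [continuous_intros]:
  fixes f :: "'b::topological_space \<Rightarrow> 'a::unital_cstar_algebra"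
  assumes "continuous_on S f"
  shows "continuous_on S (\<lambda>x. star (f x))"
proof -
  have "continuous_on UNIV (star :: 'a \<Rightarrow> 'a)"
    by (rule lipschitz_on_continuous_on[of 1])
       (auto simp: lipschitz_on_def dist_norm norm_star simp flip: star_diff)
  then show ?thesis using assms continuous_on_compose2 by blast
qed

text \<open>The square root is \<open>1 - y\<close> for the fixed point \<open>y\<close> of the contraction \<open>y \<mapsto> (z + y\<^sup>2) / 2\<close>.\<close>
lemma sqrt_one_minus:
  fixes z :: "'a::unital_cstar_algebra"
  assumes "star z = z" "norm z < 1"
  obtains h where "star h = h" "h * h = 1 - z" "norm (1 - h) < 1"
    "\<And>w. w * z = z * w \<Longrightarrow> w * h = h * w"
proof -
  define q where "q = norm z"
  \<comment> \<open>Self-adjointness, the norm bound and commutation with whatever commutes with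
    \<open>z\<close> are closed conditions preserved by the iteration, so the fixed point inherits
    them.\<close>
  define S where "S = {y. star y = y \<and> norm y \<le> q \<and> (\<forall>w. w * z = z * w \<longrightarrow> w * y = y * w)}"
  have q: "0 \<le> q" "q < 1" using assms by (auto simp: q_def)
  have S: "star y = y" "norm y \<le> q" "w * z = z * w \<Longrightarrow> w * y = y * w" if "y \<in> S" for y w
    using that unfolding S_def by blast+
  have "S = {y. star y = y} \<inter> {y. norm y \<le> q} \<inter> (\<Inter>w\<in>{w. w * z = z * w}. {y. w * y = y * w})"
    by (auto simp: S_def)
  also have "closed \<dots>"
    by (intro closed_Int closed_INT ballI closed_Collect_eq closed_Collect_le continuous_intros)
  finally have cl: "complete S" by (simp add: complete_eq_closed)
  have "\<exists>!y\<in>S. (1/2) *\<^sub>R (z + y * y) = y"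
  proof (rule Banach_fix[OF cl _ q])
    show "S \<noteq> {}" using q by (auto simp: S_def intro!: exI[of _ 0])
    show "(\<lambda>y. (1/2) *\<^sub>R (z + y * y)) ` S \<subseteq> S"
    proof clarify
      fix y assume y: "y \<in> S"
      have "norm (z + y * y) \<le> q + norm y * norm y"
        by (smt (verit) norm_triangle_ineq norm_mult_ineq q_def)
      also have "\<dots> \<le> q + q * 1" using S(2)[OF y] q by (intro add_left_mono mult_mono) auto
      finally have "norm ((1/2) *\<^sub>R (z + y * y)) \<le> q" by simp
      moreover have "\<forall>w. w * z = z * w \<longrightarrow> w * ((1/2) *\<^sub>R (z + y * y)) = ((1/2) *\<^sub>R (z + y * y)) * w"
      proof (intro allI impI)
        fix w assume that: "w * z = z * w"
        have "w * y = y * w" using S(3)[OF y that] .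
        then have "w * (y * y) = y * y * w" by (metis mult.assoc)
        then show "w * ((1/2) *\<^sub>R (z + y * y)) = ((1/2) *\<^sub>R (z + y * y)) * w"
          using that by (simp add: distrib_left distrib_right)
      qed
      moreover have "star ((1/2) *\<^sub>R (z + y * y)) = (1/2) *\<^sub>R (z + y * y)"
        using S(1)[OF y] assms(1) by (simp add: star_simps)
      ultimately show "(1/2) *\<^sub>R (z + y * y) \<in> S" unfolding S_def by blast
    qed
    fix x y assume xy: "x \<in> S" "y \<in> S"
    have "(1/2) *\<^sub>R (z + x * x) - (1/2) *\<^sub>R (z + y * y) = (1/2) *\<^sub>R (x * (x - y) + (x - y) * y)"
      by (simp add: algebra_simps)
    moreover have "norm (x * (x - y) + (x - y) * y) \<le> q * norm (x - y) + norm (x - y) * q"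
      by (intro norm_triangle_mono order_trans[OF norm_mult_ineq] mult_mono)
         (use xy q in \<open>auto simp: S(2)\<close>)
    ultimately show "dist ((1/2) *\<^sub>R (z + x * x)) ((1/2) *\<^sub>R (z + y * y)) \<le> q * dist x y"
      by (simp add: dist_norm)
  qed
  then obtain y where y: "y \<in> S" and fixp: "(1/2) *\<^sub>R (z + y * y) = y" by auto
  have "z + y * y = 2 *\<^sub>R y" by (metis fixp scaleR_half_double scaleR_2 scaleR_right_distrib)
  then have "z = y + y - y * y" by (simp add: scaleR_2 eq_diff_eq)
  then have "(1 - y) * (1 - y) = 1 - z" by (simp add: algebra_simps)
  moreover have "star (1 - y) = 1 - y" "norm (1 - (1 - y)) < 1"
    using S(1,2)[OF y] q by (simp_all add: star_simps)
  moreover have "w * (1 - y) = (1 - y) * w" if "w * z = z * w" for w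
    using S(3)[OF y that] by (simp add: algebra_simps)
  ultimately show ?thesis using that by blast
qed

section \<open>The positive cone\<close>

lemma scaleC_one: "1 *\<^sub>C (x::'a::unital_cstar_algebra) = x"
  by (metis of_real_1 scaleC_of_real scaleR_one)

lemma scaleC_minus: "(- c) *\<^sub>C (x::'a::unital_cstar_algebra) = - (c *\<^sub>C x)"
  by (metis mult_minus1 of_real_1 of_real_minus scaleC_of_real scaleC_scaleC scaleR_minus1_left)

lemma scaleC_diff_right: "c *\<^sub>C (x - y) = c *\<^sub>C x - c *\<^sub>C (y::'a::unital_cstar_algebra)"
  by (metis add_diff_cancel diff_add_cancel scaleC_add_right)

lemma scaleC_ii_ii: "\<i> *\<^sub>C \<i> *\<^sub>C (x::'a::unital_cstar_algebra) = - x"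
  by (simp add: scaleC_scaleC scaleC_minus scaleC_one)

lemma norm_scalar_le: "r \<ge> 0 \<Longrightarrow> norm (r *\<^sub>R (1::'a::unital_cstar_algebra)) \<le> r"
  using norm_scaleR_one_le[of r, where 'a='a] by linarith

text \<open>The two squares add up to \<open>star x * x\<close> for the normal element
  \<open>x = b + i d\<close>, and \<open>b\<close> is the real part of \<open>x\<close>, so its norm
  is at most that of \<open>x\<close>.\<close>

lemma norm_commuting_squares:
  fixes b d :: "'a::unital_cstar_algebra"
  assumes "star b = b" "star d = d" "b * d = d * b"
  shows "(norm b)\<^sup>2 \<le> norm (b * b + d * d)"
proof -
  define x where "x = b + \<i> *\<^sub>C d"
  have sx: "star x = b - \<i> *\<^sub>C d"
    using assms by (simp add: x_def star_simps star_scaleC scaleC_minus)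
  have "star x * x = b * b + d * d"
    unfolding sx unfolding x_def
    by (simp add: algebra_simps mult_scaleC_left mult_scaleC_right scaleC_add_right
        scaleC_diff_right scaleC_ii_ii assms(3))
  then have n: "norm (b * b + d * d) = (norm x)\<^sup>2" using cstar_identity[of x] by simp
  have "2 *\<^sub>R b = x + star x" unfolding sx unfolding x_def by (simp add: scaleR_2)
  then have "2 * norm b \<le> norm x + norm (star x)"
    by (metis norm_triangle_ineq norm_scaleR abs_numeral)
  then have "norm b \<le> norm x" by (simp add: norm_star)
  then show ?thesis unfolding n by (intro power_mono) auto
qed

text \<open>Positivity is defined by the norm, so that sums of positive elements are positive for
  trivial reasons; \<open>psdI\<close> below identifies it with the spectral notion.\<close>
definition psd :: "'a::unital_cstar_algebra \<Rightarrow> bool"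
  where "psd a \<longleftrightarrow> star a = a \<and> (\<exists>s\<ge>0. norm (s *\<^sub>R 1 - a) \<le> s)"

definition posdef :: "'a::unital_cstar_algebra \<Rightarrow> bool"
  where "posdef a \<longleftrightarrow> psd a \<and> two_sided_invertible a"

definition le_sa :: "'a::unital_cstar_algebra \<Rightarrow> 'a \<Rightarrow> bool"  (infix "\<preceq>" 50)
  where "a \<preceq> b \<longleftrightarrow> psd (b - a)"

lemma psd_star: "psd a \<Longrightarrow> star a = a"
  by (simp add: psd_def)

lemma posdef_psd: "posdef a \<Longrightarrow> psd a"
  by (simp add: posdef_def)

lemma posdef_invertible: "posdef a \<Longrightarrow> two_sided_invertible a"
  by (simp add: posdef_def)

lemma posdef_star: "posdef a \<Longrightarrow> star a = a"
  by (simp add: posdef_def psd_def)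

lemma psd_add:
  assumes "psd a" "psd b" shows "psd (a + b)"
proof -
  obtain s t where "s \<ge> 0" "norm (s *\<^sub>R 1 - a) \<le> s" "t \<ge> 0" "norm (t *\<^sub>R 1 - b) \<le> t"
    using assms by (auto simp: psd_def)
  moreover have "(s + t) *\<^sub>R 1 - (a + b) = (s *\<^sub>R 1 - a) + (t *\<^sub>R 1 - b)"
    by (simp add: algebra_simps)
  ultimately have "norm ((s + t) *\<^sub>R 1 - (a + b)) \<le> s + t" "s + t \<ge> 0"
    by (simp_all only: norm_triangle_mono add_nonneg_nonneg)
  then show ?thesis using assms by (auto simp: psd_def star_simps)
qed

lemma psd_scaleR:
  assumes "psd a" "r \<ge> 0" shows "psd (r *\<^sub>R a)"
proof -
  obtain s where "s \<ge> 0" "norm (s *\<^sub>R 1 - a) \<le> s" using assms by (auto simp: psd_def)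
  moreover have "(r * s) *\<^sub>R 1 - r *\<^sub>R a = r *\<^sub>R (s *\<^sub>R 1 - a)" by (simp add: algebra_simps)
  ultimately have "norm ((r * s) *\<^sub>R 1 - r *\<^sub>R a) \<le> r * s" "r * s \<ge> 0"
    using assms(2) by (auto intro: mult_left_mono)
  then show ?thesis using assms by (auto simp: psd_def star_simps)
qed

lemma psd_scalar: "r \<ge> 0 \<Longrightarrow> psd (r *\<^sub>R 1)"
  unfolding psd_def by (auto simp: star_simps intro!: exI[of _ r])

lemma psd_zero: "psd 0"
  using psd_scalar[of 0] by simp

text \<open>For \<open>b = sqrt (s - a^2)\<close>, which commutes with \<open>a\<close>,
  \<open>norm_commuting_squares\<close> gives
  \<open>(norm b)^2 \<le> norm (b^2 + a^2) = norm (s 1) \<le> s\<close>.\<close>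

lemma norm_diff_square:
  fixes a :: "'a::unital_cstar_algebra"
  assumes "star a = a" "(norm a)\<^sup>2 < s" shows "norm (s *\<^sub>R 1 - a * a) \<le> s"
proof -
  have s: "s > 0" using assms(2) zero_le_power2[of "norm a"] by linarith
  have "norm ((1 / s) *\<^sub>R (a * a)) = (norm a)\<^sup>2 / s"
    using s norm_square_sa[OF assms(1)] by simp
  then have nz: "norm ((1 / s) *\<^sub>R (a * a)) < 1" using s assms(2) by simp
  have "star ((1 / s) *\<^sub>R (a * a)) = (1 / s) *\<^sub>R (a * a)" using assms(1) by (simp add: star_simps)
  then obtain h where h: "star h = h" "h * h = 1 - (1 / s) *\<^sub>R (a * a)"
    "\<And>w. w * ((1 / s) *\<^sub>R (a * a)) = ((1 / s) *\<^sub>R (a * a)) * w \<Longrightarrow> w * h = h * w"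
    using nz by (rule sqrt_one_minus) blast
  define b where "b = sqrt s *\<^sub>R h"
  have b: "star b = b" "b * b = s *\<^sub>R 1 - a * a"
    using s by (simp_all add: b_def star_simps h(1,2) scaleR_diff_right)
  have "b * a = a * b" using h(3)[of a] by (simp add: b_def mult.assoc)
  from norm_commuting_squares[OF b(1) assms(1) this]
  have "norm (b * b) \<le> norm (s *\<^sub>R (1::'a))" by (simp add: norm_square_sa b(1)) (simp add: b(2))
  also have "\<dots> \<le> s" using norm_scalar_le[of s, where 'a='a] s by linarith
  finally show ?thesis by (simp add: b(2))
qed

lemma psd_square:
  fixes a :: "'a::unital_cstar_algebra"
  assumes "star a = a" shows "psd (a * a)"
  using norm_diff_square[OF assms, of "(norm a)\<^sup>2 + 1"] assms
  unfolding psd_def by (auto simp: star_simps intro!: exI[of _ "(norm a)\<^sup>2 + 1"])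

lemma invertible_psd_add_scalar:
  assumes "psd a" "t > 0" shows "two_sided_invertible (a + t *\<^sub>R 1)"
proof -
  obtain s where s: "s \<ge> 0" "norm (s *\<^sub>R 1 - a) \<le> s" using assms by (auto simp: psd_def)
  have "two_sided_invertible ((s + t) *\<^sub>R 1 - (s *\<^sub>R 1 - a))"
    by (rule neumann_scaled) (use s assms in linarith)
  then show ?thesis by (simp add: algebra_simps)
qed

text \<open>Adding \<open>t\<close> makes \<open>z = (s - a) / (s + t)\<close> strictly shorter than
  1, and \<open>a + t\<close> is \<open>s + t\<close> times \<open>1 - z\<close>. A self-adjoint
  root of \<open>1 - z\<close> at distance less than 1 from 1 is both positive and
  invertible.\<close>

lemma psd_add_scalar_sqrt:
  assumes "psd a" "t > 0"
  obtains h where "posdef h" "h * h = a + t *\<^sub>R 1" "\<And>w. w * a = a * w \<Longrightarrow> w * h = h * w"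
proof -
  obtain s where s: "s \<ge> 0" "norm (s *\<^sub>R 1 - a) \<le> s" using assms by (auto simp: psd_def)
  define z where "z = (1 / (s + t)) *\<^sub>R (s *\<^sub>R 1 - a)"
  have "norm z = norm (s *\<^sub>R 1 - a) / (s + t)" using s(1) assms(2) by (simp add: z_def)
  then have nz: "norm z < 1" using s assms(2) by (simp add: divide_less_eq)
  have "star z = z" using assms by (simp add: z_def star_simps psd_star)
  then obtain h where h: "star h = h" "h * h = 1 - z" "norm (1 - h) < 1"
    "\<And>w. w * z = z * w \<Longrightarrow> w * h = h * w" using nz by (rule sqrt_one_minus) blast
  define g where "g = sqrt (s + t) *\<^sub>R h"
  have "psd h" using h(1,3) by (auto simp: psd_def intro!: exI[of _ 1])
  moreover have "two_sided_invertible h" using neumann[OF h(3)] by simp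
  ultimately have "posdef g" using s assms(2)
    by (auto simp: g_def posdef_def intro!: psd_scaleR scaleR_cinv)
  moreover have "g * g = a + t *\<^sub>R 1"
  proof -
    have "g * g = (s + t) *\<^sub>R 1 - (s + t) *\<^sub>R z"
      using s assms(2) by (simp add: g_def h(2) scaleR_diff_right)
    also have "(s + t) *\<^sub>R z = s *\<^sub>R 1 - a" using s assms(2) by (simp add: z_def)
    finally show ?thesis by (simp add: algebra_simps)
  qed
  moreover have "w * g = g * w" if "w * a = a * w" for w
    using h(4)[of w] that by (simp add: g_def z_def algebra_simps)
  ultimately show ?thesis using that by blast
qed

text \<open>The existential scale in \<open>psd\<close> can be any bound of the norm. This follows
  from \<open>norm_diff_square\<close> because \<open>a + d\<close> is a square for every
  \<open>d > 0\<close>; then \<open>d\<close> tends to 0.\<close>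

lemma psd_norm_diff:
  assumes "psd a" "norm a \<le> s" shows "norm (s *\<^sub>R 1 - a) \<le> s"
proof -
  have "norm (s *\<^sub>R 1 - a) \<le> s + e" if e: "e > 0" for e
  proof -
    define d where "d = e / 3"
    have d: "d > 0" using e by (simp add: d_def)
    obtain h where h: "posdef h" "h * h = a + d *\<^sub>R 1"
      by (rule psd_add_scalar_sqrt[OF assms(1) d]) blast
    have "(norm h)\<^sup>2 = norm (a + d *\<^sub>R 1)" using h by (metis norm_square_sa posdef_star)
    also have "\<dots> \<le> norm a + norm (d *\<^sub>R (1::'a))" by (rule norm_triangle_ineq)
    also have "\<dots> < s + 2 * d" using assms(2) norm_scalar_le[of d, where 'a='a] d by linarith
    finally have "norm ((s + 2 * d) *\<^sub>R 1 - (a + d *\<^sub>R 1)) \<le> s + 2 * d"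
      using norm_diff_square posdef_star h by metis
    moreover have "s *\<^sub>R 1 - a = ((s + 2 * d) *\<^sub>R 1 - (a + d *\<^sub>R 1)) - d *\<^sub>R 1"
      by (simp add: algebra_simps flip: scaleR_2)
    ultimately have "norm (s *\<^sub>R 1 - a) \<le> s + 2 * d + norm (d *\<^sub>R (1::'a))"
      by (metis norm_triangle_ineq4 order_trans add_right_mono)
    then show ?thesis using norm_scalar_le[of d, where 'a='a] d unfolding d_def by linarith
  qed
  then show ?thesis by (rule field_le_epsilon)
qed

text \<open>By \<open>psd_norm_diff\<close> the one scale \<open>norm a + 1\<close> serves all small
  perturbations \<open>a + u\<close>, so the norm inequality survives the limit.\<close>

lemma psd_closed:
  fixes a :: "'a::unital_cstar_algebra"
  assumes "\<And>t. t > 0 \<Longrightarrow> psd (a + t *\<^sub>R 1)" shows "psd a"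
proof -
  define s where "s = norm a + 1"
  have "norm (s *\<^sub>R 1 - a) \<le> s + t" if t: "t > 0" for t
  proof -
    define u where "u = min 1 t"
    have u: "0 < u" "u \<le> 1" "u \<le> t" using t by (auto simp: u_def)
    have "norm (a + u *\<^sub>R 1) \<le> norm a + norm (u *\<^sub>R (1::'a))" by (rule norm_triangle_ineq)
    also have "\<dots> \<le> s" using norm_scalar_le[of u, where 'a='a] u unfolding s_def by linarith
    finally have "norm (s *\<^sub>R 1 - (a + u *\<^sub>R 1)) \<le> s" using assms u psd_norm_diff by blast
    moreover have "s *\<^sub>R 1 - a = (s *\<^sub>R 1 - (a + u *\<^sub>R 1)) + u *\<^sub>R 1" by simp
    ultimately have "norm (s *\<^sub>R 1 - a) \<le> s + norm (u *\<^sub>R (1::'a))"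
      by (metis norm_triangle_ineq order_trans add_right_mono)
    then show ?thesis using norm_scalar_le[of u, where 'a='a] u by linarith
  qed
  then have "norm (s *\<^sub>R 1 - a) \<le> s" by (rule field_le_epsilon)
  moreover have "star a = a" using psd_star[OF assms[of 1]] by (simp add: star_simps)
  ultimately show ?thesis unfolding psd_def by (auto simp: s_def intro!: exI[of _ s])
qed

text \<open>With \<open>a + d = h\<^sup>2\<close> and \<open>1 - e h\<^sup>-\<^sup>2 = k\<^sup>2\<close> one has \<open>a + d - e = (hk)\<^sup>2\<close>, where \<open>e > d\<close> is
  possible because the inverses of \<open>a + d\<close> stay bounded as \<open>d\<close> tends to \<open>0\<close>.\<close>
lemma posdef_minus_scalar:
  fixes a :: "'a::unital_cstar_algebra"
  assumes "posdef a"
  obtains e where "e > 0" "psd (a - e *\<^sub>R 1)"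
proof -
  define c where "c = cinv a"
  define r where "r = norm c + 1"
  \<comment> \<open>\<open>d * r = 1/8\<close> turns the resolvent identity
    \<open>w = c - d c w\<close> into \<open>norm w \<le> 2 r\<close>; then \<open>e = 2 d\<close>
    is still small enough for \<open>norm (e w) \<le> 1/2\<close>, and \<open>a + d - e\<close> is
    \<open>a - d\<close>.\<close>
  define d where "d = 1 / (8 * r)"
  have ac: "a * c = 1" "c * a = 1" using assms by (auto simp: c_def cinv posdef_def)
  have r: "r > 0" "norm c \<le> r" by (auto simp: r_def add_nonneg_pos)
  have d: "d > 0" "d * r = 1 / 8" using r by (auto simp: d_def)
  obtain h where h: "posdef h" "h * h = a + d *\<^sub>R 1" "\<And>w. w * a = a * w \<Longrightarrow> w * h = h * w"
    by (rule psd_add_scalar_sqrt[OF posdef_psd[OF assms] d(1)]) blast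
  have ih: "two_sided_invertible h" using h(1) by (simp add: posdef_def)
  define w where "w = cinv (h * h)"
  have sh: "star h = h" using h(1) by (rule posdef_star)
  have hw: "h * h * w = 1" "w * (h * h) = 1" using cinv[OF cinv_mult(2)[OF ih ih]] by (simp_all add: w_def)
  have sw: "star w = w" using ih sh by (simp add: w_def star_cinv cinv_mult star_simps)
  have "c = c * (h * h * w)" by (simp add: hw)
  also have "\<dots> = w + d *\<^sub>R (c * w)"
    by (simp add: h(2) distrib_left distrib_right ac flip: mult.assoc)
  finally have "w = c - d *\<^sub>R (c * w)" by (simp add: algebra_simps)
  then have "norm w \<le> norm c + norm (d *\<^sub>R (c * w))" by (metis norm_triangle_ineq4)
  also have "\<dots> \<le> r + d * (r * norm w)"
  proof -
    have "norm (c * w) \<le> r * norm w"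
      using norm_mult_ineq[of c w] r(2) by (meson mult_right_mono norm_ge_zero order_trans)
    then show ?thesis using r d(1) by (auto intro!: add_mono mult_left_mono)
  qed
  also have "d * (r * norm w) = norm w / 8" using d(2) by (simp flip: mult.assoc)
  finally have nw: "norm w \<le> 2 * r" using r by linarith
  define e where "e = 2 * d"
  have "norm (e *\<^sub>R w) \<le> e * (2 * r)" using nw d by (simp add: e_def)
  also have "\<dots> = 1 / 2" using d(2) by (simp add: e_def)
  finally have nz: "norm (e *\<^sub>R w) < 1" by simp
  have "star (e *\<^sub>R w) = e *\<^sub>R w" by (simp add: star_simps sw)
  then obtain k where k: "star k = k" "k * k = 1 - e *\<^sub>R w"
    "\<And>v. v * (e *\<^sub>R w) = (e *\<^sub>R w) * v \<Longrightarrow> v * k = k * v"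
    using nz by (rule sqrt_one_minus) blast
  have "w = cinv h * cinv h" using ih by (simp add: w_def cinv_mult)
  then have "h * w = w * h" using ih by (simp add: cinv cinv_assoc mult.assoc)
  then have hk: "h * k = k * h" by (intro k(3)) simp
  have "(h * k) * (h * k) = h * h * (k * k)" by (metis hk mult.assoc)
  also have "\<dots> = a - d *\<^sub>R 1"
    by (simp add: k(2) right_diff_distrib hw) (simp add: h(2) e_def scaleR_2 flip: scaleR_scaleR)
  finally have "(h * k) * (h * k) = a - d *\<^sub>R 1" .
  moreover have "star (h * k) = h * k" by (simp add: star_simps sh k hk)
  ultimately have "psd (a - d *\<^sub>R 1)" using psd_square by metis
  then show ?thesis using that d(1) by blast
qed

text \<open>The set of all \<open>t \<ge> 0\<close> with \<open>a + t\<close> positive is closed, and it is relatively open because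
  \<open>a + t\<close> is invertible for \<open>t > 0\<close>.\<close>
lemma psdI:
  fixes a :: "'a::unital_cstar_algebra"
  assumes "star a = a" "\<And>t. t > 0 \<Longrightarrow> two_sided_invertible (a + t *\<^sub>R 1)"
  shows "psd a"
proof -
  define T where "T = {t. 0 \<le> t \<and> psd (a + t *\<^sub>R 1)}"
  define m where "m = Inf T"
  have bdd: "bdd_below T" by (auto simp: T_def bdd_below_def)
  have "norm a \<in> T"
    using assms(1) by (auto simp: T_def psd_def star_simps intro!: exI[of _ "norm a"])
  then have ne: "T \<noteq> {}" by auto
  have m0: "m \<ge> 0" unfolding m_def using ne by (intro cInf_greatest) (auto simp: T_def)
  have pm: "psd (a + m *\<^sub>R 1)"
  proof (rule psd_closed)
    fix t :: real assume "t > 0"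
    then obtain u where u: "u \<in> T" "u < m + t"
      using cInf_lessD[OF ne, of "m + t"] by (auto simp: m_def)
    then have "psd (a + u *\<^sub>R 1)" "m + t - u \<ge> 0" by (simp_all add: T_def)
    then have "psd ((a + u *\<^sub>R 1) + (m + t - u) *\<^sub>R 1)" by (rule psd_add[OF _ psd_scalar])
    then show "psd (a + m *\<^sub>R 1 + t *\<^sub>R 1)" by (simp add: algebra_simps)
  qed
  have "m = 0"
  proof (rule ccontr)
    assume "m \<noteq> 0"
    then have "m > 0" using m0 by simp
    then have "posdef (a + m *\<^sub>R 1)" using pm assms(2) by (simp add: posdef_def)
    then obtain e where e: "e > 0" "psd (a + m *\<^sub>R 1 - e *\<^sub>R 1)"
      using posdef_minus_scalar by blast
    \<comment> \<open>Truncation at 0 keeps \<open>u\<close> in \<open>T\<close>, while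
      \<open>u < m\<close> because \<open>m\<close> and \<open>e\<close> are positive.\<close>
    define u where "u = max 0 (m - e)"
    have "psd ((a + m *\<^sub>R 1 - e *\<^sub>R 1) + (u - (m - e)) *\<^sub>R 1)"
      using e(2) by (rule psd_add[OF _ psd_scalar]) (simp add: u_def)
    then have "u \<in> T" by (simp add: T_def algebra_simps u_def)
    then have "m \<le> u" unfolding m_def using bdd by (rule cInf_lower)
    then show False using e \<open>m > 0\<close> by (simp add: u_def)
  qed
  then show ?thesis using pm by simp
qed

text \<open>Up to \<open>d\<close>, \<open>a\<close> and \<open>r - a\<close> are squares of
  commuting elements \<open>b\<close> and \<open>c\<close> with \<open>b^2 + c^2\<close> a scalar
  near \<open>r\<close>; \<open>norm_commuting_squares\<close> then bounds
  \<open>b^2\<close>.\<close>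

lemma norm_le_of_psd_diff:
  fixes a :: "'a::unital_cstar_algebra"
  assumes "psd a" "psd (r *\<^sub>R 1 - a)" "r \<ge> 0"
  shows "norm a \<le> r"
proof (rule field_le_epsilon)
  fix e :: real assume e: "e > 0"
  define d where "d = e / 3"
  have d: "d > 0" using e by (simp add: d_def)
  obtain b where b: "posdef b" "b * b = a + d *\<^sub>R 1" "\<And>w. w * a = a * w \<Longrightarrow> w * b = b * w"
    by (rule psd_add_scalar_sqrt[OF assms(1) d]) blast
  obtain c where c: "posdef c" "c * c = r *\<^sub>R 1 - a + d *\<^sub>R 1"
    "\<And>w. w * (r *\<^sub>R 1 - a) = (r *\<^sub>R 1 - a) * w \<Longrightarrow> w * c = c * w"
    by (rule psd_add_scalar_sqrt[OF assms(2) d]) blast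
  have "a * b = b * a" by (rule b(3)) simp
  then have "b * c = c * b" by (intro c(3)) (simp add: algebra_simps)
  then have "(norm b)\<^sup>2 \<le> norm (b * b + c * c)"
    using norm_commuting_squares b(1) c(1) posdef_star by blast
  also have "b * b + c * c = (r + 2 * d) *\<^sub>R 1"
    by (simp add: b(2) c(2) algebra_simps scaleR_2 flip: scaleR_scaleR)
  also have "norm \<dots> \<le> r + 2 * d"
    using norm_scalar_le[of "r + 2 * d", where 'a='a] assms(3) d by linarith
  finally have "norm (b * b) \<le> r + 2 * d" using b(1) norm_square_sa posdef_star by metis
  moreover have "a = b * b - d *\<^sub>R 1" by (simp add: b(2))
  ultimately have "norm a \<le> r + 2 * d + norm (d *\<^sub>R (1::'a))"
    by (metis norm_triangle_ineq4 order_trans add_right_mono)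
  then show "norm a \<le> r + e" using norm_scalar_le[of d, where 'a='a] d unfolding d_def by linarith
qed

text \<open>The commuting positive elements \<open>r + a\<close> and \<open>r - a\<close> have
  product \<open>r^2 - a^2\<close>; after adding \<open>d\<close> to each factor it is the square of
  \<open>b * c\<close>, hence positive. The bound for \<open>a^2\<close> is then
  \<open>norm_le_of_psd_diff\<close>.\<close>

lemma norm_le_of_bounds:
  fixes a :: "'a::unital_cstar_algebra"
  assumes "psd (r *\<^sub>R 1 + a)" "psd (r *\<^sub>R 1 - a)" "r \<ge> 0"
  shows "norm a \<le> r"
proof (rule field_le_epsilon)
  fix d :: real assume d: "d > 0"
  obtain b where b: "posdef b" "b * b = r *\<^sub>R 1 + a + d *\<^sub>R 1"
    "\<And>w. w * (r *\<^sub>R 1 + a) = (r *\<^sub>R 1 + a) * w \<Longrightarrow> w * b = b * w"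
    by (rule psd_add_scalar_sqrt[OF assms(1) d]) blast
  obtain c where c: "posdef c" "c * c = r *\<^sub>R 1 - a + d *\<^sub>R 1"
    "\<And>w. w * (r *\<^sub>R 1 - a) = (r *\<^sub>R 1 - a) * w \<Longrightarrow> w * c = c * w"
    by (rule psd_add_scalar_sqrt[OF assms(2) d]) blast
  have "a * b = b * a" by (rule b(3)) (simp add: algebra_simps)
  then have bc: "b * c = c * b" by (intro c(3)) (simp add: algebra_simps)
  have sa: "star a = a" using psd_star[OF assms(1)] by (simp add: star_simps)
  have "star (b * c) = b * c" using b(1) c(1) by (simp add: posdef_star star_simps bc)
  then have "psd ((b * c) * (b * c))" by (rule psd_square)
  moreover have "(b * c) * (b * c) = (b * b) * (c * c)" by (metis bc mult.assoc)
  moreover have "(b * b) * (c * c) = ((r + d) * (r + d)) *\<^sub>R 1 - a * a"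
    by (simp add: b(2) c(2) algebra_simps mult_2 scaleR_add_left flip: scaleR_2)
  ultimately have "psd (((r + d) * (r + d)) *\<^sub>R 1 - a * a)" by simp
  then have "norm (a * a) \<le> (r + d) * (r + d)"
    using norm_le_of_psd_diff[OF psd_square[OF sa]] by simp
  then have "(norm a)\<^sup>2 \<le> (r + d)\<^sup>2" by (simp add: norm_square_sa[OF sa] power2_eq_square)
  then show "norm a \<le> r + d" by (rule power2_le_imp_le) (use assms d in simp)
qed

section \<open>The order of self-adjoint elements\<close>

lemma le_sa_refl [simp]: "a \<preceq> a"
  by (simp add: le_sa_def psd_zero)

lemma le_sa_trans [trans]: "a \<preceq> b \<Longrightarrow> b \<preceq> c \<Longrightarrow> a \<preceq> c"
  unfolding le_sa_def using psd_add[of "c - b" "b - a"] by simp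

lemma psd_antisym:
  assumes "psd a" "psd (- a)" shows "a = 0"
  using norm_le_of_bounds[of 0 a] assms by simp

lemma le_sa_antisym:
  assumes "a \<preceq> b" "b \<preceq> a" shows "a = b"
  using psd_antisym[of "b - a"] assms by (simp add: le_sa_def)

lemma psd_iff_le: "psd a \<longleftrightarrow> 0 \<preceq> a"
  by (simp add: le_sa_def)

lemma le_sa_add_scalar:
  assumes "\<And>e. e > 0 \<Longrightarrow> a \<preceq> b + e *\<^sub>R 1" shows "a \<preceq> b"
  unfolding le_sa_def
  by (rule psd_closed) (use assms in \<open>simp add: le_sa_def algebra_simps\<close>)

lemma le_sa_scaleR: "a \<preceq> b \<Longrightarrow> r \<ge> 0 \<Longrightarrow> r *\<^sub>R a \<preceq> r *\<^sub>R b"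
  unfolding le_sa_def using psd_scaleR[of "b - a" r] by (simp add: algebra_simps)

lemma le_sa_scaleR_mono: "psd a \<Longrightarrow> r \<le> s \<Longrightarrow> r *\<^sub>R a \<preceq> s *\<^sub>R a"
  unfolding le_sa_def using psd_scaleR[of a "s - r"] by (simp add: algebra_simps)

lemma le_sa_add: "a \<preceq> b \<Longrightarrow> c \<preceq> d \<Longrightarrow> a + c \<preceq> b + d"
  unfolding le_sa_def using psd_add[of "b - a" "d - c"] by (simp add: algebra_simps)

lemma le_sa_norm:
  assumes "star a = a" "norm a \<le> r" shows "a \<preceq> r *\<^sub>R 1"
proof -
  have "r \<ge> 0" using assms norm_ge_zero order_trans by blast
  then show ?thesis using assms
    by (auto simp: le_sa_def psd_def star_simps intro!: exI[of _ r])
qed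

lemma posdef_add_scalar: "psd a \<Longrightarrow> t > 0 \<Longrightarrow> posdef (a + t *\<^sub>R 1)"
  by (simp add: posdef_def invertible_psd_add_scalar psd_add psd_scalar)

lemma posdef_add:
  assumes "posdef a" "psd b" shows "posdef (a + b)"
proof -
  obtain e where e: "e > 0" "psd (a - e *\<^sub>R 1)" using posdef_minus_scalar assms(1) .
  have "posdef ((a - e *\<^sub>R 1) + b + e *\<^sub>R 1)"
    using e assms(2) by (intro posdef_add_scalar psd_add)
  then show ?thesis by (simp add: algebra_simps)
qed

lemma posdef_scaleR: "posdef a \<Longrightarrow> t > 0 \<Longrightarrow> posdef (t *\<^sub>R a)"
  by (simp add: posdef_def psd_scaleR scaleR_cinv)

lemma posdef_one: "posdef 1"
  using posdef_add_scalar[OF psd_zero, of 1] by simp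

lemma posdef_norm:
  assumes "star a = a" "norm a < t" shows "posdef (t *\<^sub>R 1 - a)" "posdef (a + t *\<^sub>R 1)"
proof -
  have "t > 0" using assms(2) norm_ge_zero order_le_less_trans by blast
  moreover have "psd (t *\<^sub>R 1 - a)" using le_sa_norm[OF assms(1), of t] assms by (simp add: le_sa_def)
  moreover have "psd (t *\<^sub>R 1 + a)"
    using le_sa_norm[of "- a" t] assms by (simp add: le_sa_def star_minus)
  moreover have "two_sided_invertible (t *\<^sub>R 1 - a)" using assms(2) by (rule neumann_scaled)
  moreover have "two_sided_invertible (t *\<^sub>R 1 - (- a))" by (rule neumann_scaled) (simp add: assms)
  ultimately show "posdef (t *\<^sub>R 1 - a)" "posdef (a + t *\<^sub>R 1)"
    by (simp_all add: posdef_def add.commute)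
qed

lemma posdef_cinv: 
  assumes "posdef a" shows "posdef (cinv a)"
proof -
  have i: "two_sided_invertible a" and s: "star a = a"
    using assms by (simp_all add: posdef_def psd_def)
  have "psd (cinv a)"
  proof (rule psdI)
    show "star (cinv a) = cinv a" using i s by (simp add: star_cinv)
    fix t :: real assume "t > 0"
    then have "two_sided_invertible (t *\<^sub>R a + 1 *\<^sub>R 1)"
      using assms by (intro invertible_psd_add_scalar psd_scaleR posdef_psd) auto
    moreover have "cinv a + t *\<^sub>R 1 = cinv a * (t *\<^sub>R a + 1 *\<^sub>R 1)"
      using i by (simp add: distrib_left cinv)
    ultimately show "two_sided_invertible (cinv a + t *\<^sub>R 1)"
      using i cinv_mult(2) invertible_cinv by metis
  qed
  then show ?thesis using i by (simp add: posdef_def invertible_cinv)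
qed

text \<open>\<open>k a k + t\<close> factors as \<open>k (a + t k^-2) k\<close>, and
  \<open>k^-2\<close> is positive and invertible, so the middle factor is invertible for
  \<open>t > 0\<close>.\<close>

lemma psd_congruence:
  assumes "star k = k" "two_sided_invertible k" "psd a" shows "psd (k * a * k)"
proof (rule psdI)
  show "star (k * a * k) = k * a * k" using assms by (simp add: star_simps psd_star mult.assoc)
  fix t :: real assume t: "t > 0"
  define c where "c = cinv k"
  have c: "k * c = 1" "c * k = 1" "two_sided_invertible c" "star c = c"
    using assms by (simp_all add: c_def cinv invertible_cinv star_cinv)
  have "posdef (c * c)" using c by (simp add: posdef_def psd_square cinv_mult)
  then have "posdef (t *\<^sub>R (c * c) + a)" using t assms by (intro posdef_add posdef_scaleR)
  then have "two_sided_invertible (k * (t *\<^sub>R (c * c) + a) * k)"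
    using assms by (simp add: cinv_mult posdef_invertible)
  moreover have "k * (t *\<^sub>R (c * c) + a) * k = k * a * k + t *\<^sub>R ((k * c) * (c * k))"
    by (simp add: distrib_left distrib_right mult.assoc)
  ultimately show "two_sided_invertible (k * a * k + t *\<^sub>R 1)" by (simp add: c)
qed

lemma posdef_congruence:
  "star k = k \<Longrightarrow> two_sided_invertible k \<Longrightarrow> posdef a \<Longrightarrow> posdef (k * a * k)"
  by (simp add: posdef_def psd_congruence cinv_mult)

lemma le_sa_congruence:
  assumes "star k = k" "two_sided_invertible k" "a \<preceq> b" shows "k * a * k \<preceq> k * b * k"
  using psd_congruence[OF assms(1,2), of "b - a"] assms(3) by (simp add: le_sa_def algebra_simps)

lemma cinv_congruence:
  assumes "two_sided_invertible k"
  shows "cinv k * (k * a * k) * cinv k = a" "k * (cinv k * a * cinv k) * k = a"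
  using assms by (simp_all add: mult.assoc cinv cinv_assoc)

lemma le_sa_congruence_iff:
  assumes "star k = k" "two_sided_invertible k"
  shows "k * a * k \<preceq> k * b * k \<longleftrightarrow> a \<preceq> b"
  using le_sa_congruence[of "cinv k" "k * a * k" "k * b * k"] le_sa_congruence[OF assms]
    assms by (auto simp: cinv_congruence star_cinv invertible_cinv)

lemma posdef_sqrt:
  assumes "posdef a"
  obtains h where "posdef h" "h * h = a"
proof -
  obtain e where e: "e > 0" "psd (a - e *\<^sub>R 1)" using posdef_minus_scalar assms .
  obtain h where h: "posdef h" "h * h = (a - e *\<^sub>R 1) + e *\<^sub>R 1"
    by (rule psd_add_scalar_sqrt[OF e(2,1)]) blast
  then show ?thesis using that by simp
qed

lemma posdef_square: "star a = a \<Longrightarrow> two_sided_invertible a \<Longrightarrow> posdef (a * a)"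
  by (simp add: posdef_def psd_square cinv_mult)

text \<open>The bridge from the order to spectra of products:
  \<open>l - a x^-1 = (l x - a) x^-1\<close>, and conjugation by the inverse root of
  \<open>x\<close> reduces the converse to \<open>psdI\<close>.\<close>

lemma le_sa_iff_invertible:
  assumes "star a = a" "posdef x"
  shows "a \<preceq> t *\<^sub>R x \<longleftrightarrow> (\<forall>l>t. two_sided_invertible (l *\<^sub>R 1 - a * cinv x))"
proof -
  have ix: "two_sided_invertible x" using assms by (simp add: posdef_def)
  have eq: "two_sided_invertible (l *\<^sub>R 1 - a * cinv x) \<longleftrightarrow> two_sided_invertible (l *\<^sub>R x - a)" for l
  proof -
    have "l *\<^sub>R 1 - a * cinv x = (l *\<^sub>R x - a) * cinv x"
      using ix by (simp add: left_diff_distrib cinv)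
    then show ?thesis
      using cinv_mult(2)[of "l *\<^sub>R x - a" "cinv x"] invertible_of_mult_right[of "cinv x" "l *\<^sub>R x - a"]
        invertible_cinv[OF ix] by auto
  qed
  obtain h where h: "posdef h" "h * h = x" using posdef_sqrt assms(2) .
  define k where "k = cinv h"
  have ih: "two_sided_invertible h" "star h = h" using h by (simp_all add: posdef_def psd_def)
  have k: "two_sided_invertible k" "star k = k"
    using ih by (simp_all add: k_def invertible_cinv star_cinv)
  have xk: "k * x * k = 1" using ih by (simp add: k_def cinv mult.assoc cinv_assoc flip: h(2))
  show ?thesis unfolding eq
  proof
    assume le: "a \<preceq> t *\<^sub>R x"
    show "\<forall>l>t. two_sided_invertible (l *\<^sub>R x - a)"
    proof (intro allI impI)
      fix l assume "l > t"
      then have "posdef ((l - t) *\<^sub>R x + (t *\<^sub>R x - a))"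
        using assms le by (intro posdef_add posdef_scaleR) (auto simp: le_sa_def)
      then show "two_sided_invertible (l *\<^sub>R x - a)" by (simp add: posdef_def algebra_simps)
    qed
  next
    assume inv: "\<forall>l>t. two_sided_invertible (l *\<^sub>R x - a)"
    have "psd (t *\<^sub>R 1 - k * a * k)"
    proof (rule psdI)
      show "star (t *\<^sub>R 1 - k * a * k) = t *\<^sub>R 1 - k * a * k"
        using assms(1) k by (simp add: star_simps mult.assoc)
      fix e :: real assume "e > 0"
      then have "two_sided_invertible (k * ((t + e) *\<^sub>R x - a) * k)"
        using inv k by (simp add: cinv_mult)
      moreover have "k * ((t + e) *\<^sub>R x - a) * k = (t + e) *\<^sub>R (k * x * k) - k * a * k"
        by (simp add: right_diff_distrib left_diff_distrib)
      moreover have "\<dots> = t *\<^sub>R 1 - k * a * k + e *\<^sub>R 1"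
        unfolding xk by (simp add: scaleR_left_distrib)
      ultimately show "two_sided_invertible (t *\<^sub>R 1 - k * a * k + e *\<^sub>R 1)" by simp
    qed
    then have "k * a * k \<preceq> k * (t *\<^sub>R x) * k" by (simp add: le_sa_def xk)
    then show "a \<preceq> t *\<^sub>R x" using le_sa_congruence_iff k by blast
  qed
qed

text \<open>Conjugating by the inverse root of \<open>b\<close> reduces to an element
  \<open>z\<close> below 1; conjugating \<open>z \<preceq> 1\<close> by the inverse root of
  \<open>z\<close> gives \<open>1 \<preceq> cinv z\<close>.\<close>

lemma cinv_antimono:
  assumes "posdef a" "posdef b" "a \<preceq> b" shows "cinv b \<preceq> cinv a"
proof -
  have one: "1 \<preceq> cinv z" if z: "posdef z" "z \<preceq> 1" for z
  proof -
    obtain h where h: "posdef h" "h * h = z" using posdef_sqrt z(1) .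
    have ih: "two_sided_invertible h" "star h = h" using h by (simp_all add: posdef_def psd_def)
    have "cinv h * z * cinv h \<preceq> cinv h * 1 * cinv h"
      using z ih by (intro le_sa_congruence) (auto simp: star_cinv invertible_cinv)
    moreover have "cinv h * 1 * cinv h = cinv z" using ih by (simp add: cinv_mult flip: h(2))
    moreover have "cinv h * z * cinv h = 1"
      using ih by (simp add: cinv mult.assoc cinv_assoc flip: h(2))
    ultimately show ?thesis by simp
  qed
  obtain k where h: "posdef k" "k * k = b" using posdef_sqrt assms(2) .
  have k: "two_sided_invertible k" "star k = k" using h by (simp_all add: posdef_def psd_def)
  define c where "c = cinv k"
  have c: "two_sided_invertible c" "star c = c" using k by (simp_all add: c_def star_cinv invertible_cinv)
  have "c * a * c \<preceq> c * b * c" using c assms(3) le_sa_congruence by blast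
  also have "c * b * c = 1" using k by (simp add: c_def cinv mult.assoc cinv_assoc flip: h(2))
  finally have "1 \<preceq> cinv (c * a * c)" using assms(1) c by (intro one posdef_congruence)
  then have "c * 1 * c \<preceq> c * cinv (c * a * c) * c" using c le_sa_congruence by blast
  moreover have "c * 1 * c = cinv b" using k by (simp add: c_def cinv_mult flip: h(2))
  moreover have "cinv (c * a * c) = k * cinv a * k"
    using k c(1) posdef_invertible[OF assms(1)] by (simp add: cinv_mult c_def cinv_cinv mult.assoc)
  moreover have "c * (k * cinv a * k) * c = cinv a"
    using cinv_congruence(1)[OF k(1)] by (simp add: c_def)
  ultimately show ?thesis by simp
qed

text \<open>Operator monotonicity of the square root. Conjugation by \<open>cinv q\<close> and the
  C*-identity give \<open>norm (p q^-1) \<le> 1\<close>, so \<open>l - p q^-1\<close> is invertible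
  for \<open>l > 1\<close>.\<close>

lemma le_sa_of_squares:
  assumes "posdef p" "posdef q" "p * p \<preceq> q * q" shows "p \<preceq> q"
proof -
  define c where "c = cinv q"
  have q: "two_sided_invertible q" "star q = q" and sp: "star p = p"
    using assms by (simp_all add: posdef_def psd_def)
  have c: "two_sided_invertible c" "star c = c" using q by (simp_all add: c_def star_cinv invertible_cinv)
  have "c * (p * p) * c \<preceq> c * (q * q) * c" using c assms(3) le_sa_congruence by blast
  also have "c * (q * q) * c = 1 *\<^sub>R 1" using q by (simp add: c_def cinv mult.assoc cinv_assoc)
  finally have le: "psd (1 *\<^sub>R 1 - c * (p * p) * c)" by (simp add: le_sa_def)
  have "psd (c * (p * p) * c)" using c psd_congruence psd_square[OF sp] by blast
  then have "norm (c * (p * p) * c) \<le> 1" using norm_le_of_psd_diff[OF _ le] by simp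
  moreover have "star (p * c) * (p * c) = c * (p * p) * c" by (simp add: star_simps c sp mult.assoc)
  ultimately have "(norm (p * c))\<^sup>2 \<le> 1" using cstar_identity[of "p * c"] by simp
  then have n: "norm (p * c) \<le> 1" by (simp add: abs_square_le_1)
  have "p \<preceq> 1 *\<^sub>R q" unfolding le_sa_iff_invertible[OF sp assms(2)]
    using n by (auto simp flip: c_def intro!: neumann_scaled)
  then show ?thesis by simp
qed

text \<open>Congruence leads from \<open>a^m\<close> to \<open>a a^m a\<close>, hence an induction
  in steps of two.\<close>

lemma posdef_power: "posdef a \<Longrightarrow> posdef (a ^ n)"
proof (induction n rule: less_induct)
  case (less n)
  consider "n = 0" | "n = 1" | m where "n = Suc (Suc m)" by (metis One_nat_def not0_implies_Suc)
  then show ?case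
  proof cases
    case (3 m)
    have "posdef (a * a ^ m * a)" using less 3 by (intro posdef_congruence) (auto simp: posdef_def psd_def)
    then show ?thesis using 3 by (simp add: power_commutes mult.assoc)
  qed (use less in \<open>auto simp: posdef_one\<close>)
qed

lemma le_sa_of_powers:
  "posdef p \<Longrightarrow> posdef q \<Longrightarrow> p ^ (2 ^ j) \<preceq> q ^ (2 ^ j) \<Longrightarrow> p \<preceq> q"
proof (induction j)
  case (Suc j)
  have "p ^ (2 ^ j) * p ^ (2 ^ j) \<preceq> q ^ (2 ^ j) * q ^ (2 ^ j)"
    using Suc.prems(3) by (simp add: mult_2 power_add)
  then show ?case using Suc posdef_power le_sa_of_squares by blast
qed simp

lemma scaleR_power: "(r *\<^sub>R a) ^ n = r ^ n *\<^sub>R a ^ n" for a :: "'a::unital_cstar_algebra"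
  by (induction n) auto

lemma one_plus_power:
  fixes x :: "'a::unital_cstar_algebra"
  shows "(1 + x) ^ n = (\<Sum>k\<le>n. real (n choose k) *\<^sub>R x ^ k)"
proof (induction n)
  case (Suc n)
  let ?c = "\<lambda>n k. real (n choose k)"
  have "(\<Sum>k\<le>Suc n. ?c (Suc n) k *\<^sub>R x ^ k) = 1 + (\<Sum>k\<le>n. ?c (Suc n) (Suc k) *\<^sub>R x ^ Suc k)"
    by (subst sum.atMost_Suc_shift) simp
  also have "\<dots> = (\<Sum>k\<le>n. ?c n k *\<^sub>R x ^ Suc k) + (1 + (\<Sum>k\<le>n. ?c n (Suc k) *\<^sub>R x ^ Suc k))"
    by (simp add: scaleR_left_distrib sum.distrib algebra_simps del: power_Suc)
  also have "1 + (\<Sum>k\<le>n. ?c n (Suc k) *\<^sub>R x ^ Suc k) = (\<Sum>k\<le>Suc n. ?c n k *\<^sub>R x ^ k)"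
    by (subst sum.atMost_Suc_shift) simp
  also have "\<dots> = (\<Sum>k\<le>n. ?c n k *\<^sub>R x ^ k)" by simp
  also have "(\<Sum>k\<le>n. ?c n k *\<^sub>R x ^ Suc k) = x * (\<Sum>k\<le>n. ?c n k *\<^sub>R x ^ k)"
    by (simp add: sum_distrib_left)
  finally show ?case by (simp add: Suc algebra_simps)
qed simp

section \<open>Homogeneous order isomorphisms of the positive cone\<close>

lemma le_sa_limit:
  assumes "star a = a" "posdef x" "\<And>t. t > s \<Longrightarrow> a \<preceq> t *\<^sub>R x"
  shows "a \<preceq> s *\<^sub>R x"
  unfolding le_sa_iff_invertible[OF assms(1,2)]
proof (intro allI impI)
  fix l assume l: "l > s"
  then have "a \<preceq> ((s + l) / 2) *\<^sub>R x" using assms(3) by simp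
  then show "two_sided_invertible (l *\<^sub>R 1 - a * cinv x)"
    using l unfolding le_sa_iff_invertible[OF assms(1,2)] by simp
qed

lemma le_sa_multiple:
  fixes a x :: "'a::unital_cstar_algebra"
  assumes "star x = x" "posdef a"
  obtains K where "K > 0" "x \<preceq> K *\<^sub>R a"
proof -
  obtain e where e: "e > 0" "psd (a - e *\<^sub>R 1)" using posdef_minus_scalar assms(2) .
  define r where "r = norm x + 1"
  have r: "r > 0" by (simp add: r_def add_nonneg_pos)
  have "x \<preceq> r *\<^sub>R 1" using assms(1) by (intro le_sa_norm) (auto simp: r_def)
  also have "r *\<^sub>R (1::'a) = (r / e) *\<^sub>R (e *\<^sub>R 1)" using e by simp
  also have "\<dots> \<preceq> (r / e) *\<^sub>R a" using e r by (intro le_sa_scaleR) (auto simp: le_sa_def)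
  finally show ?thesis using that[of "r / e"] e r by simp
qed

text \<open>The geodesic symmetry of the cone at \<open>m\<close>, playing the role of
  \<open>y \<mapsto> 2 m - y\<close> in a vector space; \<open>m\<close> is the geometric mean of
  \<open>y\<close> and \<open>reflection m y\<close>.\<close>

definition reflection :: "'a::unital_cstar_algebra \<Rightarrow> 'a \<Rightarrow> 'a"
  where "reflection m y = m * cinv y * m"

lemma posdef_reflection: "posdef m \<Longrightarrow> posdef y \<Longrightarrow> posdef (reflection m y)"
  unfolding reflection_def by (intro posdef_congruence posdef_cinv) (auto simp: posdef_def psd_def)

lemma reflection_reflection:
  assumes "posdef m" "posdef y" shows "reflection m (reflection m y) = y"
proof -
  have i: "two_sided_invertible m" "two_sided_invertible y"
    using assms by (auto simp: posdef_def)
  then have "cinv (m * cinv y * m) = cinv m * y * cinv m"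
    by (simp add: cinv_mult invertible_cinv cinv_cinv mult.assoc)
  then show ?thesis using i by (simp add: reflection_def cinv_congruence)
qed

lemma reflection_scaleR:
  assumes "posdef y" "t > 0" shows "reflection m (t *\<^sub>R y) = (1 / t) *\<^sub>R reflection m y"
  using assms by (simp add: reflection_def scaleR_cinv posdef_def)

lemma reflection_self: "posdef m \<Longrightarrow> reflection m m = m"
  by (simp add: reflection_def cinv posdef_def)

lemma reflection_antimono:
  assumes "posdef m" "posdef y" "posdef z" "y \<preceq> z"
  shows "reflection m z \<preceq> reflection m y"
  unfolding reflection_def using assms
  by (intro le_sa_congruence cinv_antimono) (auto simp: posdef_def psd_def)

text \<open>Conjugation by the inverse root of \<open>m\<close> turns the hypothesis into
  \<open>z \<preceq> t^2 z^-1\<close>. A further conjugation by the root of \<open>z\<close> gives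
  \<open>z^2 \<preceq> t^2\<close>, and roots are monotone.\<close>

lemma le_of_le_reflection:
  assumes "posdef m" "posdef y" "t > 0" "y \<preceq> t\<^sup>2 *\<^sub>R reflection m y"
  shows "y \<preceq> t *\<^sub>R m"
proof -
  obtain k where k: "posdef k" "k * k = m" using posdef_sqrt assms(1) .
  have ik: "two_sided_invertible k" "star k = k" using k by (simp_all add: posdef_def psd_def)
  define c where "c = cinv k"
  have c: "two_sided_invertible c" "star c = c"
    using ik by (simp_all add: c_def star_cinv invertible_cinv)
  define z where "z = c * y * c"
  have pz: "posdef z" using assms c by (simp add: z_def posdef_congruence)
  obtain q where q: "posdef q" "q * q = z" using posdef_sqrt pz .
  have iq: "two_sided_invertible q" "star q = q" using q by (simp_all add: posdef_def psd_def)
  have iz: "cinv z = k * cinv y * k"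
    using ik c posdef_invertible[OF assms(2)] by (simp add: z_def cinv_mult c_def cinv_cinv mult.assoc)
  have "c * y * c \<preceq> c * (t\<^sup>2 *\<^sub>R reflection m y) * c" using assms(4) c by (intro le_sa_congruence)
  also have "c * (t\<^sup>2 *\<^sub>R reflection m y) * c = t\<^sup>2 *\<^sub>R cinv z"
    using ik by (simp add: reflection_def iz c_def cinv mult.assoc cinv_assoc flip: k(2))
  finally have "q * z * q \<preceq> q * (t\<^sup>2 *\<^sub>R cinv z) * q"
    using iq unfolding z_def by (intro le_sa_congruence)
  moreover have "q * z * q = z * z" by (simp add: mult.assoc flip: q(2))
  moreover have "q * (t\<^sup>2 *\<^sub>R cinv z) * q = (t *\<^sub>R 1) * (t *\<^sub>R 1)"
    using iq by (simp add: cinv_mult mult.assoc cinv_assoc cinv power2_eq_square flip: q(2))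
  ultimately have "z \<preceq> t *\<^sub>R 1"
    using pz posdef_scaleR[OF posdef_one assms(3)] by (metis le_sa_of_squares)
  then have "k * z * k \<preceq> k * (t *\<^sub>R 1) * k" using ik by (intro le_sa_congruence)
  then show ?thesis using ik by (simp add: z_def c_def cinv_congruence k(2))
qed

text \<open>The witness is the operator geometric mean
  \<open>p^(1/2) (p^(-1/2) q p^(-1/2))^(1/2) p^(1/2)\<close>.\<close>

lemma geometric_mean_exists:
  assumes "posdef p" "posdef q"
  obtains n where "posdef n" "reflection n p = q"
proof -
  obtain k where k: "posdef k" "k * k = p" using posdef_sqrt assms(1) .
  have ik: "two_sided_invertible k" "star k = k" using k by (simp_all add: posdef_def psd_def)
  have c: "two_sided_invertible (cinv k)" "star (cinv k) = cinv k"
    using ik by (simp_all add: star_cinv invertible_cinv)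
  obtain w where w: "posdef w" "w * w = cinv k * q * cinv k"
    using posdef_sqrt[OF posdef_congruence[OF c(2,1) assms(2)]] .
  have "reflection (k * w * k) p = k * (w * w) * k"
    using ik by (simp add: reflection_def cinv_mult mult.assoc cinv_assoc flip: k(2))
  also have "\<dots> = q" unfolding w(2) using ik by (simp add: cinv_congruence)
  finally show ?thesis using that posdef_congruence[OF ik(2,1) w(1)] by blast
qed

text \<open>The inverse is a parameter and monotonicity is demanded of it as well, so that the
  notion is symmetric; homogeneity of the inverse follows. Values off the cone are left
  open.\<close>

definition cone_iso ::
    "('a::unital_cstar_algebra \<Rightarrow> 'b::unital_cstar_algebra) \<Rightarrow> ('b \<Rightarrow> 'a) \<Rightarrow> bool"
  where "cone_iso g h \<longleftrightarrow>
    (\<forall>x. posdef x \<longrightarrow> posdef (g x) \<and> h (g x) = x) \<and>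
    (\<forall>y. posdef y \<longrightarrow> posdef (h y) \<and> g (h y) = y) \<and>
    (\<forall>x y. posdef x \<longrightarrow> posdef y \<longrightarrow> x \<preceq> y \<longrightarrow> g x \<preceq> g y) \<and>
    (\<forall>x y. posdef x \<longrightarrow> posdef y \<longrightarrow> x \<preceq> y \<longrightarrow> h x \<preceq> h y) \<and>
    (\<forall>t x. t > 0 \<longrightarrow> posdef x \<longrightarrow> g (t *\<^sub>R x) = t *\<^sub>R g x)"

lemma cone_isoD:
  assumes "cone_iso g h"
  shows "posdef x \<Longrightarrow> posdef (g x)" "posdef x \<Longrightarrow> h (g x) = x"
    "posdef y \<Longrightarrow> posdef (h y)" "posdef y \<Longrightarrow> g (h y) = y"
    "posdef x \<Longrightarrow> posdef x' \<Longrightarrow> x \<preceq> x' \<Longrightarrow> g x \<preceq> g x'"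
    "posdef y \<Longrightarrow> posdef y' \<Longrightarrow> y \<preceq> y' \<Longrightarrow> h y \<preceq> h y'"
    "posdef x \<Longrightarrow> t > 0 \<Longrightarrow> g (t *\<^sub>R x) = t *\<^sub>R g x"
  using assms unfolding cone_iso_def by blast+

lemma cone_iso_inverse_scaleR:
  assumes "cone_iso g h" "posdef y" "t > 0" shows "h (t *\<^sub>R y) = t *\<^sub>R h y"
  using cone_isoD[OF assms(1)] assms(2,3) posdef_scaleR by metis

lemma cone_iso_sym:
  assumes "cone_iso g h" shows "cone_iso h g"
  unfolding cone_iso_def using cone_isoD[OF assms] cone_iso_inverse_scaleR[OF assms] by blast

text \<open>Each reflection reverses the order and inverts scalars; two of them restore
  both.\<close>

lemma cone_iso_conjugate_reflection:
  assumes "cone_iso g h" "posdef n" "posdef m"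
  shows "cone_iso (\<lambda>x. h (reflection n (g (reflection m x)))) (\<lambda>x. reflection m (h (reflection n (g x))))"
  unfolding cone_iso_def
  using assms(2,3)
  by (intro conjI allI impI)
     (simp_all add: cone_isoD[OF assms(1)] posdef_reflection reflection_reflection
       reflection_antimono reflection_scaleR cone_iso_inverse_scaleR[OF assms(1)])

text \<open>This is Vaisala's proof of the Mazur--Ulam theorem, transferred to the cone: if every \<open>g\<close> moves
  \<open>m\<close> by a factor at most \<open>t\<^sup>2\<close>, then so does \<open>\<rho> g\<^sup>-\<^sup>1 \<rho> g\<close> for the reflection \<open>\<rho>\<close> in \<open>m\<close>, and
  this forces \<open>g\<close> to move \<open>m\<close> by a factor at most \<open>t\<close>.\<close>
lemma cone_iso_fixes_midpoint_le:
  fixes a b m :: "'a::unital_cstar_algebra"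
  assumes m: "posdef m" and a: "posdef a" and b: "b = reflection m a"
    and g: "cone_iso g h" "g a = a" "g b = b"
  shows "g m \<preceq> m"
proof -
  \<comment> \<open>The bound is uniform over all isomorphisms fixing \<open>a\<close> and
    \<open>b\<close>, since each passage from \<open>t^2\<close> to \<open>t\<close> applies it to
    another isomorphism built from \<open>g\<close>.\<close>
  define P where "P t \<longleftrightarrow> (\<forall>g h. cone_iso g h \<longrightarrow> g a = a \<longrightarrow> g b = b \<longrightarrow> g m \<preceq> t *\<^sub>R m)" for t
  have pb: "posdef b" using m a by (simp add: b posdef_reflection)
  have ra: "reflection m a = b" and rb: "reflection m b = a"
    using m a by (simp_all add: b reflection_reflection)
  have step: "P t" if P: "P (t\<^sup>2)" and t: "t > 0" for t
    unfolding P_def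
  proof (intro allI impI)
    fix g h :: "'a \<Rightarrow> 'a" assume gh: "cone_iso g h" and ga: "g a = a" and gb: "g b = b"
    let ?\<rho> = "reflection m"
    let ?s = "\<lambda>x. ?\<rho> (h (?\<rho> (g x)))"
    have iso: "cone_iso ?s (\<lambda>x. h (?\<rho> (g (?\<rho> x))))"
      using cone_iso_sym[OF cone_iso_conjugate_reflection[OF gh m m]] .
    have "h a = a" "h b = b" using cone_isoD(2)[OF gh] ga gb a pb by metis+
    then have "?s a = a" "?s b = b" using ga gb ra rb by simp_all
    then have le: "?s m \<preceq> t\<^sup>2 *\<^sub>R m" using P iso unfolding P_def by blast
    have pm: "posdef (?s m)" "posdef (?\<rho> (g m))" "posdef (g m)"
      using m cone_isoD[OF gh] by (simp_all add: posdef_reflection)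
    have "?\<rho> (t\<^sup>2 *\<^sub>R m) \<preceq> ?\<rho> (?s m)"
      using le m t pm by (intro reflection_antimono posdef_scaleR) auto
    then have "(1 / t\<^sup>2) *\<^sub>R m \<preceq> h (?\<rho> (g m))"
      using m t pm cone_isoD(3)[OF gh] by (simp add: reflection_scaleR reflection_self reflection_reflection)
    then have "g ((1 / t\<^sup>2) *\<^sub>R m) \<preceq> g (h (?\<rho> (g m)))"
      using m t pm cone_isoD[OF gh] by (intro cone_isoD(5)[OF gh] posdef_scaleR) auto
    then have "(1 / t\<^sup>2) *\<^sub>R g m \<preceq> ?\<rho> (g m)" using cone_isoD(4,7)[OF gh] pm m t by simp
    from le_sa_scaleR[OF this, of "t\<^sup>2"] have "g m \<preceq> t\<^sup>2 *\<^sub>R ?\<rho> (g m)" using t by simp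
    then show "g m \<preceq> t *\<^sub>R m" using le_of_le_reflection m pm t by blast
  qed
  have pow: "P (t ^ (2 ^ n)) \<Longrightarrow> P t" if "t > 0" for t n
    using that
  proof (induction n)
    case (Suc n)
    then show ?case using step[of "t ^ (2 ^ n)"] by (simp add: power_mult mult.commute flip: power_mult)
  qed simp
  obtain K where K: "K > 0" "m \<preceq> K *\<^sub>R a" using le_sa_multiple posdef_star[OF m] a by blast
  obtain L where L: "L > 0" "a \<preceq> L *\<^sub>R m" using le_sa_multiple posdef_star[OF a] m by blast
  \<comment> \<open>A first uniform bound: \<open>m\<close> is below a multiple of the fixed point
    \<open>a\<close>, which is below a multiple of \<open>m\<close>.\<close>
  have PKL: "P t" if t: "t \<ge> K * L" for t
    unfolding P_def
  proof (intro allI impI)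
    fix g h :: "'a \<Rightarrow> 'a" assume gh: "cone_iso g h" and ga: "g a = a" and gb: "g b = b"
    have "g m \<preceq> g (K *\<^sub>R a)" using K m a by (intro cone_isoD(5)[OF gh] posdef_scaleR)
    also have "\<dots> = K *\<^sub>R a" using cone_isoD(7)[OF gh] a K ga by simp
    also have "\<dots> \<preceq> K *\<^sub>R L *\<^sub>R m" using K L by (intro le_sa_scaleR) auto
    also have "\<dots> \<preceq> t *\<^sub>R m" using t le_sa_scaleR_mono[OF posdef_psd[OF m]] by simp
    finally show "g m \<preceq> t *\<^sub>R m" .
  qed
  \<comment> \<open>For \<open>t > 1\<close> some \<open>t ^ (2 ^ n)\<close> exceeds
    \<open>K * L\<close>; \<open>n\<close> applications of \<open>step\<close> lead back to
    \<open>t\<close>.\<close>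
  have P1: "P t" if t: "t > 1" for t
  proof -
    obtain n where n: "K * L < t ^ n" using real_arch_pow[OF t] by blast
    have "t ^ n \<le> t ^ (2 ^ n)" using t by (intro power_increasing) (auto simp: less_imp_le)
    then have "P (t ^ (2 ^ n))" using PKL n by simp
    then show ?thesis using pow[of t n] t by (metis less_trans zero_less_one)
  qed
  have "g m \<preceq> 1 *\<^sub>R m"
  proof (rule le_sa_limit)
    show "star (g m) = g m" using cone_isoD(1)[OF g(1) m] posdef_star by blast
    show "g m \<preceq> t *\<^sub>R m" if "t > 1" for t using P1[OF that] g unfolding P_def by blast
  qed (rule m)
  then show ?thesis by simp
qed

lemma cone_iso_fixes_midpoint:
  assumes "posdef m" "posdef a" "b = reflection m a" "cone_iso g h" "g a = a" "g b = b"
  shows "g m = m"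
proof -
  have "posdef b" using assms by (simp add: posdef_reflection)
  then have "h a = a" "h b = b" using cone_isoD(2)[OF assms(4)] assms by metis+
  then have "h m \<preceq> m" using cone_iso_fixes_midpoint_le[OF assms(1-3) cone_iso_sym] assms by blast
  then have "m \<preceq> g m"
    using cone_isoD[OF assms(4)] assms(1) by metis
  then show ?thesis using cone_iso_fixes_midpoint_le assms le_sa_antisym by blast
qed

text \<open>With \<open>n\<close> the geometric mean of \<open>f a\<close> and \<open>f b\<close>,
  the conjugated map \<open>?g\<close> fixes \<open>a\<close> and \<open>b\<close>, hence their
  midpoint \<open>m\<close>. So \<open>f m\<close> is fixed by the reflection in \<open>n\<close>,
  whose only fixed point in the cone is \<open>n\<close>.\<close>

lemma cone_iso_reflection:
  assumes f: "cone_iso f h" and m: "posdef m" and a: "posdef a"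
  shows "f (reflection m a) = reflection (f m) (f a)"
proof -
  define b where "b = reflection m a"
  have b: "posdef b" using m a by (simp add: b_def posdef_reflection)
  have fp: "posdef (f a)" "posdef (f b)" "posdef (f m)" using cone_isoD(1)[OF f] m a b by auto
  obtain n where n: "posdef n" "reflection n (f a) = f b" using geometric_mean_exists fp(1,2) .
  let ?g = "\<lambda>x. h (reflection n (f (reflection m x)))"
  have nb: "reflection n (f b) = f a" using n fp by (metis reflection_reflection)
  have "?g a = a" using nb cone_isoD(2)[OF f] a by (simp flip: b_def)
  moreover have "?g b = b" using n cone_isoD(2)[OF f] a b m by (simp add: b_def reflection_reflection)
  ultimately have "?g m = m"
    using cone_iso_fixes_midpoint[OF m a b_def cone_iso_conjugate_reflection[OF f n(1) m]] by blast
  then have "h (reflection n (f m)) = m" using m by (simp add: reflection_self)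
  then have fix_fm: "reflection n (f m) = f m"
    using cone_isoD(4)[OF f] posdef_reflection[OF n(1) fp(3)] by metis
  have le: "f m \<preceq> n" using le_of_le_reflection[OF n(1) fp(3), of 1] fix_fm by simp
  have "n \<preceq> f m" using reflection_antimono[OF n(1) fp(3) n(1) le] fix_fm n by (simp add: reflection_self)
  then have "f m = n" using le le_sa_antisym by blast
  then show ?thesis using n by (simp add: b_def)
qed

section \<open>Unital isomorphisms: inverses, triple products and powers\<close>

context
  fixes f :: "'a::unital_cstar_algebra \<Rightarrow> 'b::unital_cstar_algebra" and h
  assumes f: "cone_iso f h" and f1: "f 1 = 1"
begin

lemma cone_iso_cinv: "posdef x \<Longrightarrow> f (cinv x) = cinv (f x)"
  using cone_iso_reflection[OF f posdef_one, of x] by (simp add: reflection_def f1)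

text \<open>\<open>x y x\<close> is the reflection of \<open>y^-1\<close> in
  \<open>x\<close>.\<close>

lemma cone_iso_triple:
  assumes "posdef x" "posdef y" shows "f (x * y * x) = f x * f y * f x"
  using cone_iso_reflection[OF f assms(1) posdef_cinv[OF assms(2)]] cone_iso_cinv[OF assms(2)]
    assms cone_isoD(1)[OF f assms(2)]
  by (simp add: reflection_def cinv_cinv posdef_def)

lemma cone_iso_square: "posdef x \<Longrightarrow> f (x * x) = f x * f x"
  using cone_iso_triple[of x 1] by (simp add: posdef_one f1)

lemma cone_iso_power: "posdef x \<Longrightarrow> f (x ^ n) = f x ^ n"
proof (induction n rule: less_induct)
  case (less n)
  consider "n = 0" | "n = 1" | m where "n = Suc (Suc m)" by (metis One_nat_def not0_implies_Suc)
  then show ?case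
  proof cases
    case (3 m)
    have "f (x * x ^ m * x) = f x * f x ^ m * f x"
      using less 3 by (simp add: cone_iso_triple posdef_power)
    then show ?thesis using 3 by (simp add: power_commutes mult.assoc)
  qed (use f1 in auto)
qed

lemma cone_iso_scalar: "r > 0 \<Longrightarrow> f (r *\<^sub>R 1) = r *\<^sub>R 1"
  using cone_isoD(7)[OF f posdef_one] f1 by simp

end

section \<open>Additivity on the cone\<close>

lemma psd_sum: "(\<And>i. i \<in> I \<Longrightarrow> psd (c i)) \<Longrightarrow> psd (sum c I)"
  by (induction I rule: infinite_finite_induct) (auto intro: psd_add psd_zero)

lemma sum_mono_le_sa: "(\<And>i. i \<in> I \<Longrightarrow> c i \<preceq> d i) \<Longrightarrow> sum c I \<preceq> sum d I"
  using psd_sum[of I "\<lambda>i. d i - c i"] by (simp add: le_sa_def sum_subtractf)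

text \<open>A root-free form of \<open>(n + 1)^(1/n) -> 1\<close> along powers of two; it holds
  because eventually \<open>2 n < (1 + e)^n\<close>.\<close>

lemma power_two_power_ge:
  fixes e :: real
  assumes "e > 0"
  obtains j where "real (2 ^ j) + 1 \<le> (1 + e) ^ (2 ^ j)"
proof -
  have "(\<lambda>n. real n / (1 + e) ^ n) \<longlonglongrightarrow> 0" using lim_n_over_pown[of "1 + e"] assms by simp
  then have "\<forall>\<^sub>F n in sequentially. real n / (1 + e) ^ n < 1 / 2" by (rule order_tendstoD) simp
  then obtain N where N: "\<And>n. n \<ge> N \<Longrightarrow> real n / (1 + e) ^ n < 1 / 2"
    by (auto simp: eventually_sequentially)
  have "N \<le> 2 ^ N" by (simp add: less_imp_le)
  from N[OF this] have "2 * real (2 ^ N) < (1 + e) ^ (2 ^ N)"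
    using assms by (simp add: field_simps)
  moreover have "(1::real) \<le> real (2 ^ N)" by simp
  ultimately show ?thesis using that[of N] by linarith
qed

text \<open>Every binomial term satisfies \<open>(n choose k) f(x)\<^sup>k \<le> f(1 + x)\<^sup>n\<close>, so
  \<open>(1 + f(x))\<^sup>n \<le> (n + 1) f(1 + x)\<^sup>n\<close>; the factor disappears on taking \<open>n\<close>-th roots, which are
  monotone for \<open>n\<close> a power of two.\<close>
lemma cone_iso_one_plus_ge:
  assumes f: "cone_iso f h" and f1: "f 1 = 1" and x: "posdef x"
  shows "1 + f x \<preceq> f (1 + x)"
proof -
  have px: "posdef (1 + x)" using x by (intro posdef_add posdef_one posdef_psd)
  have pu: "posdef (f (1 + x))" and pv: "posdef (f x)" using x px cone_isoD(1)[OF f] by auto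
  have pv1: "posdef (1 + f x)" using pv by (intro posdef_add posdef_one posdef_psd)
  have binom: "(1 + f x) ^ n \<preceq> (real n + 1) *\<^sub>R f (1 + x) ^ n" for n
  proof -
    have "real (n choose k) *\<^sub>R f x ^ k \<preceq> f (1 + x) ^ n" if k: "k \<le> n" for k
    proof -
      let ?t = "\<lambda>k. real (n choose k) *\<^sub>R x ^ k"
      have c: "real (n choose k) > 0" using k by simp
      have "(1 + x) ^ n - ?t k = sum ?t ({..n} - {k})"
        using k by (simp add: one_plus_power sum_diff1)
      moreover have "psd (sum ?t ({..n} - {k}))"
        using x by (intro psd_sum psd_scaleR posdef_psd posdef_power) auto
      ultimately have "?t k \<preceq> (1 + x) ^ n" by (simp add: le_sa_def)
      then have "f (?t k) \<preceq> f ((1 + x) ^ n)"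
        using c x px by (intro cone_isoD(5)[OF f] posdef_scaleR posdef_power)
      then show ?thesis
        using c x px by (simp add: cone_isoD(7)[OF f] posdef_power cone_iso_power[OF f f1])
    qed
    then have "(\<Sum>k\<le>n. real (n choose k) *\<^sub>R f x ^ k) \<preceq> (\<Sum>k\<le>n. f (1 + x) ^ n)"
      by (intro sum_mono_le_sa) auto
    then show ?thesis by (simp add: one_plus_power sum_constant_scaleR add.commute)
  qed
  have "1 + f x \<preceq> 1 *\<^sub>R f (1 + x)"
  proof (rule le_sa_limit)
    show "star (1 + f x) = 1 + f x" using pv1 posdef_star by blast
    fix t :: real assume t: "t > 1"
    then obtain j where j: "real (2 ^ j) + 1 \<le> t ^ (2 ^ j)" using power_two_power_ge[of "t - 1"] by auto
    have "(1 + f x) ^ (2 ^ j) \<preceq> (real (2 ^ j) + 1) *\<^sub>R f (1 + x) ^ (2 ^ j)" by (rule binom)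
    also have "\<dots> \<preceq> t ^ (2 ^ j) *\<^sub>R f (1 + x) ^ (2 ^ j)"
      using j pu by (intro le_sa_scaleR_mono posdef_psd posdef_power)
    finally have "(1 + f x) ^ (2 ^ j) \<preceq> (t *\<^sub>R f (1 + x)) ^ (2 ^ j)" by (simp add: scaleR_power)
    then show "1 + f x \<preceq> t *\<^sub>R f (1 + x)"
      using le_sa_of_powers pv1 posdef_scaleR[OF pu] t by (metis less_trans zero_less_one)
  qed (rule pu)
  then show ?thesis by simp
qed

text \<open>The reverse inequality is the same bound for the inverse \<open>h\<close>, taken at
  \<open>f x\<close>.\<close>

lemma cone_iso_one_plus:
  assumes f: "cone_iso f h" and f1: "f 1 = 1" and x: "posdef x"
  shows "f (1 + x) = 1 + f x"
proof -
  have pv: "posdef (f x)" using x cone_isoD(1)[OF f] by auto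
  then have pv1: "posdef (1 + f x)" by (intro posdef_add posdef_one posdef_psd)
  have px: "posdef (1 + x)" using x by (intro posdef_add posdef_one posdef_psd)
  have "h 1 = 1" using cone_isoD(2)[OF f posdef_one] f1 by simp
  from cone_iso_one_plus_ge[OF cone_iso_sym[OF f] this pv]
  have "1 + x \<preceq> h (1 + f x)" using cone_isoD(2)[OF f x] by simp
  then have "f (1 + x) \<preceq> f (h (1 + f x))" using px pv1 cone_isoD(3)[OF f] cone_isoD(5)[OF f] by blast
  then have "f (1 + x) \<preceq> 1 + f x" using cone_isoD(4)[OF f pv1] by simp
  then show ?thesis using cone_iso_one_plus_ge assms le_sa_antisym by blast
qed

text \<open>With \<open>k\<close> the root of \<open>x\<close>, \<open>x + y = k (1 + z) k\<close>;
  the triple identity transfers the case of \<open>1 + z\<close>.\<close>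

lemma cone_iso_add:
  assumes f: "cone_iso f h" and f1: "f 1 = 1" and x: "posdef x" and y: "posdef y"
  shows "f (x + y) = f x + f y"
proof -
  obtain k where k: "posdef k" "k * k = x" using posdef_sqrt x .
  have ik: "two_sided_invertible k" "star k = k" using k by (simp_all add: posdef_def psd_def)
  define z where "z = cinv k * y * cinv k"
  have z: "posdef z" "k * z * k = y"
    using ik y by (simp_all add: z_def cinv_congruence posdef_congruence star_cinv invertible_cinv)
  have z1: "posdef (1 + z)" using z by (intro posdef_add posdef_one posdef_psd)
  have "x + y = k * (1 + z) * k" using z(2) by (simp add: distrib_left distrib_right k(2))
  then have "f (x + y) = f k * (1 + f z) * f k"
    using cone_iso_triple[OF f f1 k(1) z1] cone_iso_one_plus[OF f f1 z(1)] by simp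
  also have "\<dots> = f (k * k) + f (k * z * k)"
    using k(1) z(1)
    by (simp add: cone_iso_square[OF f f1] cone_iso_triple[OF f f1] distrib_left distrib_right)
  finally show ?thesis by (simp add: k(2) z(2))
qed

section \<open>Separation of self-adjoint elements by spectra\<close>

text \<open>\<open>m\<close> is the top of the spectrum of \<open>d\<close>. If \<open>m - d\<close>
  were invertible it would lie above some scalar \<open>e > 0\<close>, and \<open>m - e\<close>
  would be a smaller bound. In the zero algebra every scalar is a bound, so there is no least
  one.\<close>

lemma least_scalar_bound:
  fixes d :: "'a::unital_cstar_algebra"
  assumes "star d = d" "(1::'a) \<noteq> 0"
  obtains m where "d \<preceq> m *\<^sub>R 1" "\<not> two_sided_invertible (m *\<^sub>R 1 - d)"
    "\<And>t. d \<preceq> t *\<^sub>R 1 \<Longrightarrow> m \<le> t"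
proof -
  define T where "T = {t. d \<preceq> t *\<^sub>R 1}"
  have bdd: "bdd_below T"
    unfolding bdd_below_def
  proof (intro exI ballI)
    fix t assume "t \<in> T"
    then have "d \<preceq> t *\<^sub>R 1" by (simp add: T_def)
    moreover have "- d \<preceq> norm d *\<^sub>R 1" using assms(1) by (intro le_sa_norm) (auto simp: star_minus)
    ultimately have p: "psd ((t + norm d) *\<^sub>R (1::'a))"
      using le_sa_add[of d "t *\<^sub>R 1" "- d" "norm d *\<^sub>R 1"] by (simp add: psd_iff_le scaleR_left_distrib)
    show "- norm d \<le> t"
    proof (rule ccontr)
      assume "\<not> - norm d \<le> t"
      then have "psd ((- (t + norm d)) *\<^sub>R (1::'a))" by (intro psd_scalar) simp
      then have "(t + norm d) *\<^sub>R (1::'a) = 0" using psd_antisym[OF p] by (metis scaleR_minus_left)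
      then show False using assms(2) \<open>\<not> - norm d \<le> t\<close> by simp
    qed
  qed
  have ne: "norm d \<in> T" using le_sa_norm[OF assms(1)] by (simp add: T_def)
  define m where "m = Inf T"
  have dm: "d \<preceq> m *\<^sub>R 1"
  proof (rule le_sa_limit[OF assms(1) posdef_one])
    fix t assume "t > m"
    then obtain u where "u \<in> T" "u < t" using cInf_lessD[of T t] ne by (auto simp: m_def)
    then show "d \<preceq> t *\<^sub>R 1"
      using le_sa_trans[OF _ le_sa_scaleR_mono[OF posdef_psd[OF posdef_one]], of d u t]
      by (simp add: T_def)
  qed
  have lb: "m \<le> t" if "d \<preceq> t *\<^sub>R 1" for t
    unfolding m_def using that bdd by (intro cInf_lower) (auto simp: T_def)
  have "\<not> two_sided_invertible (m *\<^sub>R 1 - d)"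
  proof
    assume "two_sided_invertible (m *\<^sub>R 1 - d)"
    then have "posdef (m *\<^sub>R 1 - d)" using dm by (simp add: posdef_def le_sa_def)
    then obtain e where e: "e > 0" "psd (m *\<^sub>R 1 - d - e *\<^sub>R 1)" by (rule posdef_minus_scalar)
    then have "d \<preceq> (m - e) *\<^sub>R 1" by (simp add: le_sa_def algebra_simps)
    then show False using lb e by fastforce
  qed
  then show ?thesis using that dm lb by blast
qed

text \<open>Let \<open>\<mu> > 0\<close> be the top of the spectrum of \<open>q - p\<close>, let \<open>r = \<mu> - (q - p)\<close>, and let \<open>\<eta>\<close> be the
  top of the spectrum of \<open>q - N r\<close>. For \<open>y = \<eta> + N r\<close> with large \<open>N\<close> the element \<open>y - q\<close> is
  singular, whereas \<open>y - p\<close> is invertible if \<open>\<eta> > 0\<close>. Hence \<open>\<eta> \<le> 0\<close>.\<close>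
lemma separation_bound:
  fixes p q :: "'a::unital_cstar_algebra"
  assumes sa: "star p = p" "star q = q" and one: "(1::'a) \<noteq> 0"
    and \<mu>: "\<mu> > 0" "q - p \<preceq> \<mu> *\<^sub>R 1" and N: "N \<ge> 1" "norm q < N * \<mu>"
    and inv: "\<And>y. posdef y \<Longrightarrow> two_sided_invertible (y - p) \<Longrightarrow> two_sided_invertible (y - q)"
  shows "q \<preceq> N *\<^sub>R (\<mu> *\<^sub>R 1 - (q - p))"
proof -
  define r where "r = \<mu> *\<^sub>R 1 - (q - p)"
  have r: "psd r" "star r = r"
    using \<mu> sa by (simp_all add: r_def le_sa_def star_simps)
  obtain \<eta> where \<eta>: "q - N *\<^sub>R r \<preceq> \<eta> *\<^sub>R 1" "\<not> two_sided_invertible (\<eta> *\<^sub>R 1 - (q - N *\<^sub>R r))"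
    using least_scalar_bound[of "q - N *\<^sub>R r"] sa r one by (auto simp: star_simps)
  define y where "y = N *\<^sub>R r + \<eta> *\<^sub>R 1"
  have yq: "y - q = \<eta> *\<^sub>R 1 - (q - N *\<^sub>R r)" by (simp add: y_def)
  then have w: "psd (y - q)" "\<not> two_sided_invertible (y - q)" using \<eta> unfolding yq by (simp_all only: le_sa_def not_False_eq_True)
  have "\<eta> \<le> 0"
  proof (rule ccontr)
    assume "\<not> \<eta> \<le> 0"
    then have py: "posdef y" using r N unfolding y_def by (intro posdef_add_scalar psd_scaleR) auto
    \<comment> \<open>Substituting \<open>y\<close> and \<open>r\<close> gives \<open>N (y - p) = (N
      - 1) (y - q) + (norm q - q) + (N \<mu> + \<eta> - norm q)\<close>: two positive terms and a
      positive scalar.\<close>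
    have "psd (norm q *\<^sub>R 1 - q)"
      using le_sa_norm[of q "norm q"] sa by (simp add: le_sa_def)
    moreover have "N * \<mu> + \<eta> - norm q > 0" using \<open>\<not> \<eta> \<le> 0\<close> N by linarith
    ultimately have "posdef (((N - 1) *\<^sub>R (y - q) + (norm q *\<^sub>R 1 - q)) + (N * \<mu> + \<eta> - norm q) *\<^sub>R 1)"
      using w(1) N(1) by (intro posdef_add_scalar psd_add psd_scaleR) auto
    also have "((N - 1) *\<^sub>R (y - q) + (norm q *\<^sub>R 1 - q)) + (N * \<mu> + \<eta> - norm q) *\<^sub>R 1 = N *\<^sub>R (y - p)"
      unfolding y_def r_def
      by (simp add: scaleR_add_left scaleR_diff_left scaleR_add_right scaleR_diff_right algebra_simps)
    finally have "posdef ((1 / N) *\<^sub>R (N *\<^sub>R (y - p)))" by (rule posdef_scaleR) (use N(1) in simp)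
    then have "two_sided_invertible (y - p)" using N(1) by (simp add: posdef_def)
    then show False using inv py w by blast
  qed
  then have "psd ((- \<eta>) *\<^sub>R (1::'a))" by (intro psd_scalar) simp
  then have "psd ((\<eta> *\<^sub>R 1 - (q - N *\<^sub>R r)) + (- \<eta>) *\<^sub>R 1)"
    using \<eta>(1) by (intro psd_add) (auto simp: le_sa_def)
  then show ?thesis by (simp add: le_sa_def r_def)
qed

text \<open>If the top \<open>\<mu>\<close> of the spectrum of \<open>q - p\<close> were positive,
  \<open>separation_bound\<close> for \<open>p, q\<close> and for \<open>-q, -p\<close> would add up
  to \<open>q - p \<preceq> 2 N (\<mu> - (q - p))\<close>. That puts \<open>q - p\<close> below
  \<open>2 N \<mu> / (2 N + 1) < \<mu>\<close>.\<close>

lemma separation_le: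
  fixes p q :: "'a::unital_cstar_algebra"
  assumes sa: "star p = p" "star q = q" and one: "(1::'a) \<noteq> 0"
    and inv: "\<And>y. posdef y \<Longrightarrow> two_sided_invertible (y - p) \<Longrightarrow> two_sided_invertible (y - q)"
      "\<And>y. posdef y \<Longrightarrow> two_sided_invertible (y + q) \<Longrightarrow> two_sided_invertible (y + p)"
  shows "q - p \<preceq> 0"
proof -
  obtain \<mu> where \<mu>: "q - p \<preceq> \<mu> *\<^sub>R 1" "\<And>t. q - p \<preceq> t *\<^sub>R 1 \<Longrightarrow> \<mu> \<le> t"
    using least_scalar_bound[of "q - p"] sa one by (auto simp: star_simps)
  have "\<mu> \<le> 0"
  proof (rule ccontr)
    assume "\<not> \<mu> \<le> 0"
    then have \<mu>0: "\<mu> > 0" by simp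
    \<comment> \<open>This makes \<open>N * \<mu>\<close> equal to
      \<open>norm p + norm q + \<mu>\<close>, above both norms, as the two uses of
      \<open>separation_bound\<close> demand.\<close>
    define N where "N = (norm p + norm q) / \<mu> + 1"
    have "N * \<mu> = norm p + norm q + \<mu>" using \<mu>0 by (simp add: N_def field_simps)
    moreover have "N \<ge> 1" using \<mu>0 by (simp add: N_def)
    ultimately
    have N: "N \<ge> 1" "norm q < N * \<mu>" "norm p < N * \<mu>"
      using \<mu>0 norm_ge_zero[of p] norm_ge_zero[of q] by linarith+
    define r where "r = \<mu> *\<^sub>R 1 - (q - p)"
    have "q \<preceq> N *\<^sub>R r"
      unfolding r_def using separation_bound[OF sa one \<mu>0 \<mu>(1) N(1,2)] inv(1) by blast
    moreover have "- p \<preceq> N *\<^sub>R r"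
      using separation_bound[of "- q" "- p" \<mu> N] sa one \<mu>0 \<mu>(1) N inv(2) by (simp add: star_minus r_def)
    ultimately have "q - p \<preceq> N *\<^sub>R r + N *\<^sub>R r" using le_sa_add by fastforce
    then have "psd ((1 / (2 * N + 1)) *\<^sub>R (N *\<^sub>R r + N *\<^sub>R r - (q - p)))"
      using N(1) by (intro psd_scaleR) (auto simp: le_sa_def)
    also have "N *\<^sub>R r + N *\<^sub>R r - (q - p) = (2 * N + 1) *\<^sub>R ((2 * N / (2 * N + 1) * \<mu>) *\<^sub>R 1 - (q - p))"
    proof -
      define D where "D = q - p"
      have e: "(2 * N + 1) * (2 * N / (2 * N + 1) * \<mu>) = 2 * (N * \<mu>)" using N(1) by simp
      have double: "(2 * t) *\<^sub>R x = t *\<^sub>R x + t *\<^sub>R x" for t and x :: 'a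
        by (metis mult_2 scaleR_add_left)
      show ?thesis
        unfolding r_def D_def[symmetric] scaleR_diff_right scaleR_scaleR e
        by (simp add: scaleR_add_left double)
    qed
    finally have "q - p \<preceq> (2 * N / (2 * N + 1) * \<mu>) *\<^sub>R 1" using N(1) by (simp add: le_sa_def)
    then have "\<mu> \<le> 2 * N / (2 * N + 1) * \<mu>" by (rule \<mu>(2))
    then show False using N(1) \<mu>0 by (simp add: field_simps)
  qed
  then have "psd ((- \<mu>) *\<^sub>R (1::'a))" by (intro psd_scalar) simp
  then have "psd ((\<mu> *\<^sub>R 1 - (q - p)) + (- \<mu>) *\<^sub>R 1)"
    using \<mu>(1) by (intro psd_add) (auto simp: le_sa_def)
  then show ?thesis by (simp add: le_sa_def)
qed

lemma separation:
  fixes p q :: "'a::unital_cstar_algebra"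
  assumes "star p = p" "star q = q"
    and "\<And>y. posdef y \<Longrightarrow> two_sided_invertible (y - p) \<longleftrightarrow> two_sided_invertible (y - q)"
    and "\<And>y. posdef y \<Longrightarrow> two_sided_invertible (y + p) \<longleftrightarrow> two_sided_invertible (y + q)"
  shows "p = q"
proof (cases "(1::'a) = 0")
  case True
  then show ?thesis by (metis mult_1_right mult_zero_right)
next
  case False
  then have "q - p \<preceq> 0" "p - q \<preceq> 0" using separation_le assms by blast+
  then show ?thesis using le_sa_antisym[of p q] by (simp add: le_sa_def)
qed

section \<open>Extension to all self-adjoint elements\<close>

text \<open>The shift moves a self-adjoint \<open>a\<close> into the cone, where \<open>f\<close> is
  additive; by \<open>linear_ext_eq\<close> every other shift into the cone gives the same
  value.\<close>

definition linear_ext ::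
    "('a::unital_cstar_algebra \<Rightarrow> 'b::unital_cstar_algebra) \<Rightarrow> 'a \<Rightarrow> 'b"
  where "linear_ext f a = f (a + (norm a + 1) *\<^sub>R 1) - (norm a + 1) *\<^sub>R 1"

lemma posdef_scalar: "t > 0 \<Longrightarrow> posdef (t *\<^sub>R 1)"
  by (simp add: posdef_scaleR posdef_one)

context
  fixes f :: "'a::unital_cstar_algebra \<Rightarrow> 'b::unital_cstar_algebra" and h
  assumes f: "cone_iso f h" and f1: "f 1 = 1"
begin

lemma linear_ext_eq:
  assumes "posdef (a + t *\<^sub>R 1)" shows "f (a + t *\<^sub>R 1) = linear_ext f a + t *\<^sub>R 1"
proof -
  have sa: "star a = a" using posdef_star[OF assms] by (simp add: star_simps)
  define c where "c = norm a + 1"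
  have pc: "posdef (a + c *\<^sub>R 1)" using sa by (intro posdef_norm) (auto simp: c_def)
  \<comment> \<open>Both shifts are raised to the common larger one \<open>K\<close>; the
    differences are positive scalars, which a unital \<open>f\<close> fixes.\<close>
  define K where "K = \<bar>t\<bar> + \<bar>c\<bar> + 1"
  have shift: "f (a + K *\<^sub>R 1) = f (a + s *\<^sub>R 1) + (K - s) *\<^sub>R 1" if "posdef (a + s *\<^sub>R 1)" "s < K" for s
  proof -
    have "a + K *\<^sub>R 1 = (a + s *\<^sub>R 1) + (K - s) *\<^sub>R 1" by (simp add: algebra_simps)
    then show ?thesis
      using that(2) cone_iso_add[OF f f1 that(1) posdef_scalar[of "K - s"]]
      by (simp add: cone_iso_scalar[OF f f1] add.assoc)
  qed
  have "f (a + t *\<^sub>R 1) + (K - t) *\<^sub>R 1 = f (a + c *\<^sub>R 1) + (K - c) *\<^sub>R 1"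
    using shift[OF assms] shift[OF pc] by (simp add: K_def)
  then show ?thesis unfolding linear_ext_def c_def[symmetric] by (simp add: algebra_simps)
qed

lemma linear_ext_posdef: "posdef x \<Longrightarrow> linear_ext f x = f x"
  using linear_ext_eq[of x 0] by simp

lemma linear_ext_star: 
  assumes "star a = a" shows "star (linear_ext f a) = linear_ext f a"
proof -
  have "posdef (a + (norm a + 1) *\<^sub>R 1)" using assms by (intro posdef_norm) auto
  then have "star (f (a + (norm a + 1) *\<^sub>R 1)) = f (a + (norm a + 1) *\<^sub>R 1)"
    using cone_isoD(1)[OF f] posdef_star by blast
  then show ?thesis by (simp add: linear_ext_def star_simps)
qed

lemma linear_ext_add:
  assumes "star a = a" "star b = b"
  shows "linear_ext f (a + b) = linear_ext f a + linear_ext f b"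
proof -
  define t where "t = norm a + norm b + 1"
  have p: "posdef (a + t *\<^sub>R 1)" "posdef (b + t *\<^sub>R 1)"
    using assms by (auto intro!: posdef_norm simp: t_def add_nonneg_pos add_pos_nonneg)
  have eq: "a + b + (t + t) *\<^sub>R 1 = (a + t *\<^sub>R 1) + (b + t *\<^sub>R 1)"
    unfolding scaleR_add_left by simp
  have "posdef (a + b + (t + t) *\<^sub>R 1)" unfolding eq by (rule posdef_add[OF p(1) posdef_psd[OF p(2)]])
  then have "linear_ext f (a + b) + (t + t) *\<^sub>R 1 = f (a + b + (t + t) *\<^sub>R 1)"
    by (simp only: linear_ext_eq)
  also have "\<dots> = (linear_ext f a + linear_ext f b) + (t + t) *\<^sub>R 1"
    unfolding eq unfolding cone_iso_add[OF f f1 p] linear_ext_eq[OF p(1)] linear_ext_eq[OF p(2)]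
    by (simp only: scaleR_add_left add.assoc add.left_commute)
  finally show ?thesis by simp
qed

lemma linear_ext_zero: "linear_ext f 0 = 0"
  using linear_ext_add[of 0 0] by simp

lemma linear_ext_minus: "star a = a \<Longrightarrow> linear_ext f (- a) = - linear_ext f a"
  using linear_ext_add[of "- a" a] linear_ext_zero by (simp add: star_minus eq_neg_iff_add_eq_0)

lemma linear_ext_scaleR:
  assumes "star a = a" shows "linear_ext f (r *\<^sub>R a) = r *\<^sub>R linear_ext f a"
proof -
  have pos: "linear_ext f (r *\<^sub>R a) = r *\<^sub>R linear_ext f a" if "r > 0" for r
  proof -
    let ?t = "norm a + 1"
    have p: "posdef (a + ?t *\<^sub>R 1)" using assms by (intro posdef_norm) auto
    then have "posdef (r *\<^sub>R (a + ?t *\<^sub>R 1))" using that by (intro posdef_scaleR)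
    then have p': "posdef (r *\<^sub>R a + (r * ?t) *\<^sub>R 1)" by (simp add: scaleR_add_right)
    have "linear_ext f (r *\<^sub>R a) + (r * ?t) *\<^sub>R 1 = f (r *\<^sub>R (a + ?t *\<^sub>R 1))"
      using linear_ext_eq[OF p'] by (simp add: scaleR_add_right)
    also have "\<dots> = r *\<^sub>R (linear_ext f a + ?t *\<^sub>R 1)"
      using cone_isoD(7)[OF f p that] linear_ext_eq[OF p] by simp
    finally show ?thesis by (simp add: scaleR_add_right)
  qed
  consider "r > 0" | "r = 0" | "r < 0" by linarith
  then show ?thesis
  proof cases
    case 3
    then have "linear_ext f ((- r) *\<^sub>R a) = (- r) *\<^sub>R linear_ext f a" by (intro pos) simp
    then show ?thesis using linear_ext_minus[of "r *\<^sub>R a"] assms by (simp add: star_simps)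
  qed (use pos linear_ext_zero in auto)
qed

text \<open>Squares are preserved on the cone. For \<open>u = a + t\<close> the terms of
  \<open>u^2\<close> other than \<open>a^2\<close> are affine in \<open>a\<close>, so they match on
  both sides and cancel.\<close>

lemma linear_ext_square:
  assumes sa: "star a = a" shows "linear_ext f (a * a) = linear_ext f a * linear_ext f a"
proof -
  let ?T = "linear_ext f"
  define t where "t = norm a + 1"
  define u where "u = a + t *\<^sub>R 1"
  have u: "posdef u" unfolding u_def using sa by (intro posdef_norm) (auto simp: t_def)
  have uu: "u * u = a * a + ((t + t) *\<^sub>R a + (t * t) *\<^sub>R 1)"
    by (simp only: u_def distrib_left distrib_right add.assoc scaleR_add_left scaleR_add_right mult_scaleR_left
        mult_scaleR_right mult_1_left mult_1_right scaleR_scaleR)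
  have T1: "?T 1 = 1" by (simp add: linear_ext_posdef posdef_one f1)
  have "?T (u * u) = f (u * u)" using u posdef_square[of u] by (simp add: linear_ext_posdef posdef_def psd_def)
  also have "\<dots> = (?T a + t *\<^sub>R 1) * (?T a + t *\<^sub>R 1)"
    using linear_ext_eq[of a t] u by (simp add: cone_iso_square[OF f f1] u_def)
  also have "?T (u * u) = ?T (a * a) + ((t + t) *\<^sub>R ?T a + (t * t) *\<^sub>R 1)"
    unfolding uu using sa by (simp add: linear_ext_add linear_ext_scaleR star_simps T1)
  finally have "?T (a * a) + ((t + t) *\<^sub>R ?T a + (t * t) *\<^sub>R 1)
      = ?T a * ?T a + ((t + t) *\<^sub>R ?T a + (t * t) *\<^sub>R 1)"
    by (simp only: distrib_left distrib_right add.assoc scaleR_add_left scaleR_add_right mult_scaleR_left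
        mult_scaleR_right mult_1_left mult_1_right scaleR_scaleR)
  then show ?thesis by simp
qed

end

lemma linear_ext_inverse:
  assumes f: "cone_iso f h" and f1: "f 1 = 1" and a: "star a = a" shows "linear_ext h (linear_ext f a) = a"
proof -
  let ?t = "norm a + 1"
  have h1: "h 1 = 1" using cone_isoD(2)[OF f posdef_one] f1 by simp
  have p: "posdef (a + ?t *\<^sub>R 1)" using a by (intro posdef_norm) auto
  have "posdef (linear_ext f a + ?t *\<^sub>R 1)"
    using cone_isoD(1)[OF f p] linear_ext_eq[OF f f1 p] by simp
  then have "h (linear_ext f a + ?t *\<^sub>R 1) = linear_ext h (linear_ext f a) + ?t *\<^sub>R 1"
    by (rule linear_ext_eq[OF cone_iso_sym[OF f] h1])
  moreover have "h (linear_ext f a + ?t *\<^sub>R 1) = a + ?t *\<^sub>R 1"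
    using cone_isoD(2)[OF f p] linear_ext_eq[OF f f1 p] by simp
  ultimately show ?thesis by simp
qed

text \<open>\<open>a * a\<close> is positive and invertible, so its image is too; that image is the
  square of \<open>linear_ext f a\<close>.\<close>

lemma linear_ext_invertible:
  assumes f: "cone_iso f h" "f 1 = 1" and a: "star a = a" "two_sided_invertible a"
  shows "two_sided_invertible (linear_ext f a)"
proof -
  have "posdef (a * a)" using a by (rule posdef_square)
  then have "posdef (linear_ext f (a * a))"
    using linear_ext_posdef[OF f] cone_isoD(1)[OF f(1)] by simp
  then show ?thesis
    using linear_ext_square[OF f a(1)] invertible_of_commuting_mult posdef_invertible by metis
qed

lemma linear_ext_invertible_iff:
  assumes f: "cone_iso f h" "f 1 = 1" and a: "star a = a"
  shows "two_sided_invertible (linear_ext f a) \<longleftrightarrow> two_sided_invertible a"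
proof -
  have "h 1 = 1" using cone_isoD(2)[OF f(1) posdef_one] f(2) by simp
  then show ?thesis
    using linear_ext_invertible[OF f a] linear_ext_invertible[OF cone_iso_sym[OF f(1)]]
      linear_ext_star[OF f a] linear_ext_inverse[OF f a] by metis
qed

lemma jordan_isomorphism_linear_ext:
  assumes f: "cone_iso f h" "f 1 = 1"
  shows "jordan_isomorphism (linear_ext f)"
proof -
  let ?T = "linear_ext f"
  have h: "cone_iso h f" "h 1 = 1"
    using cone_iso_sym[OF f(1)] cone_isoD(2)[OF f(1) posdef_one] f(2) by simp_all
  have "bij_betw ?T self_adjoints self_adjoints"
    by (rule bij_betw_byWitness[where f' = "linear_ext h"])
       (auto simp: self_adjoints_def linear_ext_inverse[OF f] linear_ext_inverse[OF h]
         linear_ext_star[OF f] linear_ext_star[OF h])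
  moreover have "?T (jordan_product a b) = jordan_product (?T a) (?T b)"
    if ab: "star a = a" "star b = b" for a b
  proof -
    \<comment> \<open>Polarisation: the Jordan product is a combination of squares.\<close>
    have sq: "jordan_product x y = (1/2) *\<^sub>R ((x + y) * (x + y) - x * x - y * y)" for x y :: "'c::unital_cstar_algebra"
      by (simp add: jordan_product_def algebra_simps)
    have m: "linear_ext f (x - y) = linear_ext f x - linear_ext f y"
      if "star x = x" "star y = y" for x y
      using linear_ext_add[OF f, of x "- y"] linear_ext_minus[OF f] that by (simp add: star_minus)
    show ?thesis unfolding sq using ab
      by (simp add: linear_ext_scaleR[OF f] m linear_ext_square[OF f] linear_ext_add[OF f] star_simps)
  qed
  ultimately show ?thesis
    unfolding jordan_isomorphism_def jordan_homomorphism_def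
    by (simp add: self_adjoints_def linear_ext_star[OF f] linear_ext_add[OF f] linear_ext_scaleR[OF f])
qed

section \<open>Maps preserving the spectrum of products\<close>

lemma invertible_iff_spectrum:
  "two_sided_invertible (r *\<^sub>R 1 - z) \<longleftrightarrow> complex_of_real r \<notin> alg_spectrum z"
  by (simp add: alg_spectrum_def scaleC_of_real)

lemma invertible_add_scalar_iff:
  "two_sided_invertible (a + t *\<^sub>R 1) \<longleftrightarrow> two_sided_invertible ((- t) *\<^sub>R 1 - a)"
proof -
  have "- (a + t *\<^sub>R 1) = (- t) *\<^sub>R 1 - a" by simp
  then show ?thesis by (metis invertible_minus)
qed

context
  fixes f :: "'a::unital_cstar_algebra \<Rightarrow> 'b::unital_cstar_algebra"
  assumes onto: "f ` self_adjoints = self_adjoints"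
    and spec: "\<And>a b. star a = a \<Longrightarrow> star b = b \<Longrightarrow> alg_spectrum (f a * f b) = alg_spectrum (a * b)"
    and f1: "f 1 = 1"
begin

lemma spec_star: "star a = a \<Longrightarrow> star (f a) = f a"
  using onto by (auto simp: self_adjoints_def)

lemma spec_onto:
  assumes "star b = b" obtains a where "star a = a" "f a = b"
proof -
  have "b \<in> f ` self_adjoints" using assms onto by (simp add: self_adjoints_def)
  then show ?thesis using that by (auto simp: self_adjoints_def)
qed

lemma spec_invertible:
  assumes "star a = a" "star b = b"
  shows "two_sided_invertible (r *\<^sub>R 1 - f a * f b) \<longleftrightarrow> two_sided_invertible (r *\<^sub>R 1 - a * b)"
  by (simp add: invertible_iff_spectrum spec assms)

text \<open>Pairing with the unit shows that \<open>f a\<close> and \<open>a\<close> have the same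
  spectrum, and its real points decide positivity.\<close>

lemma spec_posdef:
  assumes "star a = a" shows "posdef (f a) \<longleftrightarrow> posdef a"
proof -
  have inv: "two_sided_invertible (f a + t *\<^sub>R 1) \<longleftrightarrow> two_sided_invertible (a + t *\<^sub>R 1)" for t
    unfolding invertible_add_scalar_iff
    using spec_invertible[OF assms star_one, of "- t"] f1 by simp
  have "psd (f a)" if "psd a"
    using inv invertible_psd_add_scalar[OF that] spec_star[OF assms] by (intro psdI) auto
  moreover have "psd a" if "psd (f a)"
    using inv invertible_psd_add_scalar[OF that] assms by (intro psdI) auto
  ultimately show ?thesis using inv[of 0] by (auto simp: posdef_def)
qed

lemma spec_onto_posdef:
  assumes "posdef b" obtains a where "posdef a" "f a = b"
  using spec_onto[OF posdef_star[OF assms]] spec_posdef assms by metis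

text \<open>By \<open>le_sa_iff_invertible\<close> the relation is a statement about the spectrum of
  \<open>a * u\<close>. The value of \<open>f\<close> at \<open>cinv u\<close> is not yet known,
  hence the form \<open>cinv (f u)\<close>.\<close>

lemma spec_le_cinv_iff:
  assumes "star a = a" "posdef u"
  shows "f a \<preceq> t *\<^sub>R cinv (f u) \<longleftrightarrow> a \<preceq> t *\<^sub>R cinv u"
proof -
  have su: "star u = u" using assms by (simp add: posdef_star)
  have pu: "posdef (f u)" using spec_posdef[OF su] assms by simp
  show ?thesis
    using le_sa_iff_invertible[OF spec_star[OF assms(1)] posdef_cinv[OF pu]]
      le_sa_iff_invertible[OF assms(1) posdef_cinv[OF assms(2)]]
      posdef_invertible[OF pu] posdef_invertible[OF assms(2)]
    by (simp add: cinv_cinv spec_invertible assms su)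
qed

text \<open>The order is tested against elements slightly above the upper one, written as inverses:
  \<open>b + e\<close> as \<open>cinv u\<close> and, by surjectivity, \<open>f b + e\<close> as
  \<open>cinv (f u)\<close>.\<close>

lemma spec_le_iff:
  assumes a: "star a = a" and b: "posdef b" shows "f a \<preceq> f b \<longleftrightarrow> a \<preceq> b"
proof
  assume le: "f a \<preceq> f b"
  show "a \<preceq> b"
  proof (rule le_sa_add_scalar)
    fix e :: real assume "e > 0"
    then have "posdef (b + e *\<^sub>R 1)" using b by (intro posdef_add_scalar posdef_psd)
    define u where "u = cinv (b + e *\<^sub>R 1)"
    have u: "posdef u" "cinv u = b + e *\<^sub>R 1"
      using \<open>posdef (b + e *\<^sub>R 1)\<close> by (simp_all add: u_def posdef_cinv cinv_cinv posdef_invertible)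
    have "b \<preceq> cinv u" using \<open>e > 0\<close> by (simp add: u le_sa_def psd_scalar)
    then have "f b \<preceq> cinv (f u)" using spec_le_cinv_iff[OF posdef_star[OF b] u(1), of 1] by simp
    with le have "f a \<preceq> cinv (f u)" by (rule le_sa_trans)
    then show "a \<preceq> b + e *\<^sub>R 1" using spec_le_cinv_iff[OF a u(1), of 1] by (simp add: u)
  qed
next
  have pb: "posdef (f b)" using spec_posdef[OF posdef_star[OF b]] b by simp
  assume le: "a \<preceq> b"
  show "f a \<preceq> f b"
  proof (rule le_sa_add_scalar)
    fix e :: real assume "e > 0"
    then have pe: "posdef (f b + e *\<^sub>R 1)" using pb by (intro posdef_add_scalar posdef_psd)
    then obtain u where u: "posdef u" "f u = cinv (f b + e *\<^sub>R 1)"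
      using spec_onto_posdef[OF posdef_cinv] by blast
    have cu: "cinv (f u) = f b + e *\<^sub>R 1" using pe by (simp add: u cinv_cinv posdef_invertible)
    have "f b \<preceq> cinv (f u)" using \<open>e > 0\<close> by (simp add: cu le_sa_def psd_scalar)
    then have "b \<preceq> cinv u" using spec_le_cinv_iff[OF posdef_star[OF b] u(1), of 1] by simp
    with le have "a \<preceq> cinv u" by (rule le_sa_trans)
    then show "f a \<preceq> f b + e *\<^sub>R 1" using spec_le_cinv_iff[OF a u(1), of 1] by (simp add: cu)
  qed
qed

text \<open>One inequality is immediate from \<open>spec_le_cinv_iff\<close>. For the other, a
  preimage of \<open>t cinv (f u)\<close> lies below \<open>t cinv u\<close>, and \<open>f\<close>
  is monotone.\<close>

lemma spec_cinv_scaleR: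
  assumes u: "posdef u" and t: "t > 0" shows "f (t *\<^sub>R cinv u) = t *\<^sub>R cinv (f u)"
proof -
  have pu: "posdef (f u)" using spec_posdef[OF posdef_star[OF u]] u by simp
  have p: "posdef (t *\<^sub>R cinv u)" using u t by (intro posdef_scaleR posdef_cinv)
  have "f (t *\<^sub>R cinv u) \<preceq> t *\<^sub>R cinv (f u)"
    using spec_le_cinv_iff[OF posdef_star[OF p] u, of t] by simp
  moreover obtain a where a: "posdef a" "f a = t *\<^sub>R cinv (f u)"
    using spec_onto_posdef posdef_scaleR[OF posdef_cinv[OF pu] t] .
  have "a \<preceq> t *\<^sub>R cinv u" using spec_le_cinv_iff[OF posdef_star[OF a(1)] u, of t] a by simp
  then have "t *\<^sub>R cinv (f u) \<preceq> f (t *\<^sub>R cinv u)"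
    using spec_le_iff[OF posdef_star[OF a(1)] p] a by simp
  ultimately show ?thesis by (rule le_sa_antisym)
qed

lemma spec_cinv: "posdef u \<Longrightarrow> f (cinv u) = cinv (f u)"
  using spec_cinv_scaleR[of u 1] by simp

lemma spec_scaleR:
  assumes "posdef x" "t > 0" shows "f (t *\<^sub>R x) = t *\<^sub>R f x"
  using spec_cinv_scaleR[OF posdef_cinv[OF assms(1)] assms(2)] spec_cinv[OF posdef_cinv[OF assms(1)]]
    assms(1) by (simp add: cinv_cinv posdef_invertible)

lemma spec_cone_iso: "cone_iso f (inv_into (Collect posdef) f)"
proof -
  have "inj_on f (Collect posdef)"
  proof (rule inj_onI)
    fix x y assume "x \<in> Collect posdef" "y \<in> Collect posdef" "f x = f y"
    then show "x = y"
      using spec_le_iff[of x y] spec_le_iff[of y x] by (simp add: le_sa_antisym posdef_star)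
  qed
  moreover have "f ` Collect posdef = Collect posdef"
    using spec_posdef posdef_star by (auto elim: spec_onto_posdef)
  ultimately have bij: "bij_betw f (Collect posdef) (Collect posdef)" by (simp add: bij_betw_def)
  let ?h = "inv_into (Collect posdef) f"
  have hf: "?h (f x) = x" if "posdef x" for x using bij_betw_inv_into_left[OF bij] that by simp
  have fh: "f (?h y) = y" if "posdef y" for y using bij_betw_inv_into_right[OF bij] that by simp
  have hp: "posdef (?h y)" if "posdef y" for y
    using bij_betw_apply[OF bij_betw_inv_into[OF bij]] that by simp
  show ?thesis
    unfolding cone_iso_def
  proof (intro conjI allI impI)
    fix x y :: 'b assume "posdef x" "posdef y" "x \<preceq> y"
    then show "?h x \<preceq> ?h y" using spec_le_iff[OF posdef_star hp, of "?h x" y] fh hp by simp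
  qed (simp_all add: hf fh hp spec_posdef spec_scaleR spec_le_iff posdef_star)
qed

text \<open>\<open>f x - f a\<close> is \<open>1 - f a (f x)^-1\<close> times \<open>f x\<close>,
  and \<open>(f x)^-1\<close> is \<open>f (x^-1)\<close>; so membership of 1 in the spectrum of
  \<open>a x^-1\<close> decides the difference, and membership of -1 the sum.\<close>

lemma spec_invertible_add:
  assumes a: "star a = a" and x: "posdef x"
  shows "two_sided_invertible (f x - f a) \<longleftrightarrow> two_sided_invertible (x - a)"
    "two_sided_invertible (f x + f a) \<longleftrightarrow> two_sided_invertible (x + a)"
proof -
  have eq: "two_sided_invertible (r *\<^sub>R y - c) \<longleftrightarrow> two_sided_invertible (r *\<^sub>R 1 - c * cinv y)"
    if "posdef y" for r and c y :: "'c::unital_cstar_algebra"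
  proof -
    have i: "two_sided_invertible y" using that by (rule posdef_invertible)
    have "(r *\<^sub>R 1 - c * cinv y) * y = r *\<^sub>R y - c" using i by (simp add: left_diff_distrib cinv mult.assoc)
    then show ?thesis using i cinv_mult(2) invertible_of_mult_right by metis
  qed
  have fx: "posdef (f x)" using spec_posdef[OF posdef_star[OF x]] x by simp
  have "two_sided_invertible (r *\<^sub>R f x - f a) \<longleftrightarrow> two_sided_invertible (r *\<^sub>R x - a)" for r
    using spec_invertible[OF a posdef_star[OF posdef_cinv[OF x]], of r]
    by (simp add: eq[OF x] eq[OF fx] spec_cinv[OF x])
  from this[of 1] this[of "-1"]
  show "two_sided_invertible (f x - f a) \<longleftrightarrow> two_sided_invertible (x - a)"
    "two_sided_invertible (f x + f a) \<longleftrightarrow> two_sided_invertible (x + a)"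
    using invertible_minus[of "f x + f a"] invertible_minus[of "x + a"] by simp_all
qed

text \<open>Every positive invertible \<open>y\<close> is \<open>f x\<close> for some
  \<open>x\<close> in the cone, where \<open>f\<close> and its extension agree. Invertibility of
  \<open>y\<close> minus or plus either candidate reduces to that of \<open>x - a\<close> or
  \<open>x + a\<close>, so \<open>separation\<close> applies.\<close>

lemma spec_eq_linear_ext:
  assumes a: "star a = a" shows "f a = linear_ext f a"
proof (rule separation)
  note ci = spec_cone_iso f1
  let ?T = "linear_ext f"
  show "star (f a) = f a" using a by (rule spec_star)
  show sT: "star (?T a) = ?T a" using linear_ext_star[OF ci a] .
  fix y :: 'b assume "posdef y"
  then obtain x where x: "posdef x" "f x = y" by (rule spec_onto_posdef)
  have sx: "star x = x" using x posdef_star by blast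
  have "?T (x - a) = y - ?T a" "?T (x + a) = y + ?T a"
    using linear_ext_add[OF ci sx, of a] linear_ext_add[OF ci sx, of "- a"] linear_ext_minus[OF ci a]
      linear_ext_posdef[OF ci x(1)] a x(2) by (simp_all add: star_minus)
  then show "two_sided_invertible (y - f a) \<longleftrightarrow> two_sided_invertible (y - ?T a)"
    "two_sided_invertible (y + f a) \<longleftrightarrow> two_sided_invertible (y + ?T a)"
    using spec_invertible_add[OF a x(1)] x(2)
      linear_ext_invertible_iff[OF ci, of "x - a"] linear_ext_invertible_iff[OF ci, of "x + a"] a sx
    by (simp_all add: star_simps)
qed

lemma spec_jordan_isomorphism: "jordan_isomorphism f"
proof -
  have "jordan_isomorphism (linear_ext f)" by (rule jordan_isomorphism_linear_ext[OF spec_cone_iso f1])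
  moreover have "bij_betw (linear_ext f) self_adjoints self_adjoints
      \<longleftrightarrow> bij_betw f self_adjoints self_adjoints"
    by (rule bij_betw_cong) (simp add: self_adjoints_def spec_eq_linear_ext)
  moreover have "star (jordan_product a b) = jordan_product a b" if "star a = a" "star b = b"
    for a b :: 'a
    using that by (simp add: jordan_product_def star_simps add.commute)
  ultimately show ?thesis
    unfolding jordan_isomorphism_def jordan_homomorphism_def
    by (simp add: self_adjoints_def spec_eq_linear_ext star_simps)
qed

end

section \<open>Spectral criteria for the unit and for zero, and centrality\<close>

lemma eq_one_if_spectrum:
  fixes a :: "'a::unital_cstar_algebra"
  assumes sa: "star a = a" and spec: "alg_spectrum a \<subseteq> {1}" shows "a = 1"
proof -
  have inv: "two_sided_invertible (r *\<^sub>R 1 - a)" if "r \<noteq> 1" for r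
    using that spec unfolding invertible_iff_spectrum by auto
  have "psd (1 - a)"
  proof (rule psdI)
    fix t :: real assume "t > 0"
    then show "two_sided_invertible (1 - a + t *\<^sub>R 1)" using inv[of "1 + t"] by (simp add: algebra_simps)
  qed (simp add: star_simps sa)
  moreover have "psd (- (1 - a))"
  proof (rule psdI)
    fix t :: real assume "t > 0"
    then show "two_sided_invertible (- (1 - a) + t *\<^sub>R 1)"
      using inv[of "1 - t"] invertible_minus[of "(1 - t) *\<^sub>R 1 - a"] by (simp add: algebra_simps)
  qed (simp add: star_simps sa)
  ultimately show ?thesis using psd_antisym[of "1 - a"] by simp
qed

text \<open>With \<open>c = i t\<close> one has \<open>-(c - a) (c + a) = a^2 + t^2\<close>, which
  is invertible since \<open>a^2\<close> is positive.\<close>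

lemma imaginary_notin_spectrum:
  fixes a :: "'a::unital_cstar_algebra"
  assumes sa: "star a = a" and t: "t \<noteq> 0" shows "\<i> * complex_of_real t \<notin> alg_spectrum a"
proof -
  define c where "c = (\<i> * complex_of_real t) *\<^sub>C (1::'a)"
  have ca: "c * a = a * c" by (simp add: c_def mult_scaleC_left mult_scaleC_right)
  have cc: "c * c = - (t\<^sup>2 *\<^sub>R 1)"
  proof -
    have "c * c = (\<i> * complex_of_real t * (\<i> * complex_of_real t)) *\<^sub>C 1"
      by (simp add: c_def mult_scaleC_left mult_scaleC_right scaleC_scaleC)
    also have "\<i> * complex_of_real t * (\<i> * complex_of_real t) = - complex_of_real (t\<^sup>2)"
      by (simp add: power2_eq_square algebra_simps)
    finally show ?thesis unfolding scaleC_minus scaleC_of_real .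
  qed
  have "two_sided_invertible (a * a + t\<^sup>2 *\<^sub>R 1)"
    using t sa by (intro invertible_psd_add_scalar psd_square) auto
  moreover have "(c - a) * (- (c + a)) = a * a + t\<^sup>2 *\<^sub>R 1" "(- (c + a)) * (c - a) = a * a + t\<^sup>2 *\<^sub>R 1"
    by (simp_all add: algebra_simps ca cc)
  ultimately have "two_sided_invertible (c - a)" using invertible_of_commuting_mult by metis
  then show ?thesis by (simp add: alg_spectrum_def c_def)
qed

lemma scaleC_minus_right: "c *\<^sub>C (- x) = (- c) *\<^sub>C (x::'a::unital_cstar_algebra)"
  by (metis mult_minus1_right scaleC_minus scaleC_one scaleC_scaleC)

lemma invertible_scaleC:
  fixes x :: "'a::unital_cstar_algebra"
  assumes "two_sided_invertible x" "c \<noteq> 0" shows "two_sided_invertible (c *\<^sub>C x)"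
proof (rule invertibleI)
  show "c *\<^sub>C x * ((1 / c) *\<^sub>C cinv x) = 1" "(1 / c) *\<^sub>C cinv x * (c *\<^sub>C x) = 1"
    using assms cinv[OF assms(1)]
    by (simp_all add: mult_scaleC_left mult_scaleC_right scaleC_scaleC scaleC_one)
qed

text \<open>\<open>z\<close> is \<open>i\<close> times a self-adjoint \<open>w\<close> with no
  nonzero real spectral point; so \<open>w\<close> and \<open>-w\<close> are both positive.\<close>

lemma skew_adjoint_eq_zero:
  fixes z :: "'a::unital_cstar_algebra"
  assumes sk: "star z = - z" and spec: "\<And>t. t \<noteq> 0 \<Longrightarrow> \<i> * complex_of_real t \<notin> alg_spectrum z"
  shows "z = 0"
proof -
  define w where "w = (- \<i>) *\<^sub>C z"
  have z: "z = \<i> *\<^sub>C w" by (simp add: w_def scaleC_scaleC scaleC_one)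
  have sw: "star w = w" by (simp add: w_def star_scaleC sk scaleC_minus_right)
  have inv: "two_sided_invertible (t *\<^sub>R 1 - w)" if "t \<noteq> 0" for t
  proof -
    have "two_sided_invertible ((- \<i>) *\<^sub>C ((\<i> * complex_of_real t) *\<^sub>C 1 - z))"
      using spec[OF that] by (intro invertible_scaleC) (auto simp: alg_spectrum_def)
    moreover have "(- \<i>) *\<^sub>C ((\<i> * complex_of_real t) *\<^sub>C 1 - z) = t *\<^sub>R 1 - w"
      unfolding scaleC_diff_right w_def by (simp add: scaleC_scaleC scaleC_of_real flip: mult.assoc)
    ultimately show ?thesis by simp
  qed
  have "psd (- w)" using inv by (intro psdI) (auto simp: star_minus sw)
  moreover have "psd w"
  proof (rule psdI)
    fix t :: real assume "t > 0"
    then show "two_sided_invertible (w + t *\<^sub>R 1)"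
      unfolding invertible_add_scalar_iff by (intro inv) simp
  qed (rule sw)
  ultimately have "w = 0" by (intro psd_antisym)
  then show ?thesis using z scaleC_diff_right[of \<i> w w] by simp
qed

lemma alg_spectrum_one: "alg_spectrum (1::'a::unital_cstar_algebra) \<subseteq> {1}"
proof
  fix c assume c: "c \<in> alg_spectrum (1::'a)"
  have "c *\<^sub>C 1 - 1 = (c - 1) *\<^sub>C (1::'a)"
    by (metis scaleC_add_left scaleC_one diff_add_cancel add_diff_cancel)
  then have "\<not> two_sided_invertible ((c - 1) *\<^sub>C (1::'a))" using c by (simp add: alg_spectrum_def)
  then show "c \<in> {1}" using invertible_scaleC[OF invertible_one, of "c - 1"] by auto
qed

text \<open>\<open>x + star x\<close> and \<open>i (x - star x)\<close> are self-adjoint, and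
  \<open>x\<close> is a complex combination of them.\<close>

lemma commutes_if_commutes_sa:
  fixes s :: "'a::unital_cstar_algebra"
  assumes sa: "\<And>x. star x = x \<Longrightarrow> s * x = x * s" shows "s * x = x * s"
proof -
  have p: "s * (x + star x) = (x + star x) * s" by (rule sa) (simp add: star_simps add.commute)
  have "s * (\<i> *\<^sub>C (x - star x)) = \<i> *\<^sub>C (x - star x) * s"
    by (rule sa) (simp add: star_simps star_scaleC flip: scaleC_minus_right)
  then have "\<i> *\<^sub>C \<i> *\<^sub>C (s * (x - star x)) = \<i> *\<^sub>C \<i> *\<^sub>C ((x - star x) * s)"
    by (simp add: mult_scaleC_left mult_scaleC_right)
  then have m: "s * (x - star x) = (x - star x) * s" by (simp add: scaleC_ii_ii)
  have "2 *\<^sub>R (s * x) = s * (x + star x) + s * (x - star x)" by (simp add: algebra_simps scaleR_2)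
  also have "\<dots> = 2 *\<^sub>R (x * s)" unfolding p m by (simp add: algebra_simps scaleR_2)
  finally show ?thesis by simp
qed

theorem theorem1:
  fixes \<phi> :: "'a::unital_cstar_algebra \<Rightarrow> 'b::unital_cstar_algebra"
  assumes "\<phi> ` self_adjoints = self_adjoints"
    and "\<And>a b. a \<in> self_adjoints \<Longrightarrow> b \<in> self_adjoints \<Longrightarrow>
           alg_spectrum (\<phi> a * \<phi> b) = alg_spectrum (a * b)"
  shows "\<exists>s J. central_symmetry (s::'b) \<and> jordan_isomorphism (J::'a \<Rightarrow> 'b) \<and>
           (\<forall>a\<in>self_adjoints. \<phi> a = s * J a)"
proof -
  have spec: "alg_spectrum (\<phi> a * \<phi> b) = alg_spectrum (a * b)" if "star a = a" "star b = b" for a b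
    using assms(2) that by (simp add: self_adjoints_def)
  have \<phi>_star: "star (\<phi> a) = \<phi> a" if "star a = a" for a
    using assms(1) that by (auto simp: self_adjoints_def)
  have \<phi>_onto: "\<exists>a. star a = a \<and> \<phi> a = b" if "star b = b" for b
  proof -
    have "b \<in> \<phi> ` self_adjoints" using that assms(1) by (simp add: self_adjoints_def)
    then show ?thesis by (auto simp: self_adjoints_def)
  qed
  define s where "s = \<phi> 1"
  have ss: "star s = s" by (simp add: s_def \<phi>_star)
  have s2: "s * s = 1"
  proof (rule eq_one_if_spectrum)
    show "star (s * s) = s * s" by (simp add: star_simps ss)
    show "alg_spectrum (s * s) \<subseteq> {1}" using spec[of 1 1] alg_spectrum_one by (simp add: s_def)
  qed
  have s2': "s * (s * x) = x" for x by (simp add: s2 flip: mult.assoc)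
  have central: "s * x = x * s" for x
  proof (rule commutes_if_commutes_sa)
    fix x :: 'b assume x: "star x = x"
    obtain b where b: "star b = b" "\<phi> b = x - s * x * s"
      using \<phi>_onto[of "x - s * x * s"] x ss by (auto simp: star_simps mult.assoc)
    have sy: "s * \<phi> b = s * x - x * s" by (simp add: b(2) right_diff_distrib s2' mult.assoc)
    have "s * \<phi> b = 0"
    proof (rule skew_adjoint_eq_zero)
      show "star (s * \<phi> b) = - (s * \<phi> b)" by (simp add: sy star_simps x ss)
      fix t :: real assume "t \<noteq> 0"
      then show "\<i> * complex_of_real t \<notin> alg_spectrum (s * \<phi> b)"
        using imaginary_notin_spectrum[OF b(1)] spec[OF star_one b(1)] by (simp add: s_def)
    qed
    then show "s * x = x * s" by (simp add: sy)
  qed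
  define J where "J a = s * \<phi> a" for a
  have "jordan_isomorphism J"
  proof (rule spec_jordan_isomorphism)
    show "J ` self_adjoints = self_adjoints"
    proof (intro equalityI subsetI)
      fix y assume "y \<in> J ` self_adjoints"
      then show "y \<in> self_adjoints"
        by (auto simp: J_def self_adjoints_def star_simps \<phi>_star ss central[symmetric])
    next
      fix y :: 'b assume "y \<in> self_adjoints"
      then have "star (s * y) = s * y" using central[of y] by (simp add: self_adjoints_def star_simps ss)
      then obtain a where "star a = a" "\<phi> a = s * y" using \<phi>_onto by blast
      then show "y \<in> J ` self_adjoints"
        by (intro image_eqI[of _ _ a]) (simp_all add: J_def s2' self_adjoints_def)
    qed
    fix a b :: 'a assume ab: "star a = a" "star b = b"
    \<comment> \<open>Centrality brings the two factors \<open>s\<close> together, where they cancel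
      and leave \<open>\<phi> a * \<phi> b\<close>.\<close>
    have "J a * J b = s * (s * \<phi> a) * \<phi> b" unfolding J_def by (metis central mult.assoc)
    then show "alg_spectrum (J a * J b) = alg_spectrum (a * b)" using spec[OF ab] by (simp add: s2')
  next
    show "J 1 = 1" by (simp add: J_def s2 flip: s_def)
  qed
  moreover have "central_symmetry s"
    unfolding central_symmetry_def
  proof
    show "symmetry_element s"
      by (simp add: symmetry_element_def unitary_element_def self_adjoints_def ss s2)
  qed (use central in blast)
  moreover have "\<forall>a\<in>self_adjoints. \<phi> a = s * J a" by (simp add: J_def s2')
  ultimately show ?thesis by blast
qed

end
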